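(* Let $X\ne\{0\}$ be a complex Banach space with open unit ball $B_X$. Let $k,q\in\mathbb{N}$ and $p>0$, and put $$R_5=R^{k,p,q}=\sqrt[qk]{\frac{\min\{p,2\}}{2+\min\{p,2\}}}.$$ Let $f:B_X\to\mathbb{D}$ be holomorphic with homogeneous polynomial expansion $f(z)=\sum_{j=0}^\infty P_j(z)$, $z\in B_X$, and $a=|f(0)|$. Let $\mu_k:B_X\to B_X$ be a Schwarz mapping having a zero of order $k$ at $z=0$. Then $$J_f(z):=a^p+\sum_{j=1}^\infty|P_{qj}(\mu_k(z))|+\Big(\frac1{1+a}+\frac{r^{qk}}{1-r^{qk}}\Big)\sum_{j=1}^\infty|P_{qj}(\mu_k(z))|^2\le1$$ for $\|z\|=r\le R_5$. The radius $R_5$ is best possible: for every $R\in(R_5,1)$ there exist such $f$ and $\mu_k$ and a point $z\in B_X$ with $\|z\|=r\le R$ such that $J_f(z)>1$.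
   Context: $\mathbb{N}=\{1,2,\dots\}$ and $\mathbb{D}=\{z\in\mathbb{C}:|z|<1\}$. A homogeneous polynomial of degree $j$ on $X$ is a map $P_j(x)=u(x,\dots,x)$ for a (continuous) $j$-linear map $u$ on $X^j$; $P_0$ is the constant $f(0)$. Every holomorphic $f:B_X\to\mathbb{D}$ has a unique expansion $f(z)=\sum_{j\ge0}P_j(z)$ on $B_X$ with $P_j$ homogeneous of degree $j$. A Schwarz mapping is a holomorphic map $\mu:B_X\to B_X$ with $\mu(0)=0$; it has a zero of order $k$ at $0$ if the first non-zero term of its homogeneous polynomial expansion at $0$ has degree $k$. *)

theory Defs
  imports "HOL-Analysis.Analysis"
begin

text \<open>The distribution only has real Banach spaces. The real structure required by \<^class>\<open>banach\<close>
  is tied to the complex one by \<open>scaleR_scaleC\<close>.\<close>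

class complex_banach = banach +
  fixes scaleC :: "complex \<Rightarrow> 'a \<Rightarrow> 'a" (infixr "*\<^sub>C" 75)
  assumes scaleC_add_right: "c *\<^sub>C (x + y) = c *\<^sub>C x + c *\<^sub>C y"
    and scaleC_add_left: "(c + d) *\<^sub>C x = c *\<^sub>C x + d *\<^sub>C x"
    and scaleC_scaleC: "c *\<^sub>C d *\<^sub>C x = (c * d) *\<^sub>C x"
    and scaleC_one: "1 *\<^sub>C x = x"
    and scaleR_scaleC: "scaleR t x = complex_of_real t *\<^sub>C x"
    and norm_scaleC: "norm (c *\<^sub>C x) = cmod c * norm x"

instantiation complex :: complex_banach
begin

definition scaleC_complex :: "complex \<Rightarrow> complex \<Rightarrow> complex"
  where "scaleC_complex c x = c * x"

instance
  by standard
    (simp_all add: scaleC_complex_def distrib_left distrib_right norm_mult scaleR_conv_of_real)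

end

text \<open>Frechet differentiability with a complex-linear derivative; boundedness of the derivative
  is part of \<^const>\<open>has_derivative\<close>. On the open sets considered here it is differentiability
  in the usual two-sided sense.\<close>

definition holomorphic_map_on ::
    "('a::complex_banach \<Rightarrow> 'b::complex_banach) \<Rightarrow> 'a set \<Rightarrow> bool"
  where "holomorphic_map_on f S \<longleftrightarrow>
    (\<forall>x\<in>S. \<exists>f'. (f has_derivative f') (at x) \<and> (\<forall>c v. f' (c *\<^sub>C v) = c *\<^sub>C f' v))"

text \<open>A \<open>j\<close>-linear map on the \<open>j\<close>-fold product is represented by a function of infinite sequences
  that depends on the entries with index below \<open>j\<close> only. For such functions, continuity in the
  product topology of \<^typ>\<open>nat \<Rightarrow> 'a\<close> is joint continuity in these \<open>j\<close> arguments.\<close>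

definition continuous_multilinear ::
    "nat \<Rightarrow> ((nat \<Rightarrow> 'a::complex_banach) \<Rightarrow> 'b::complex_banach) \<Rightarrow> bool"
  where "continuous_multilinear j u \<longleftrightarrow>
    (\<forall>x y. (\<forall>i<j. x i = y i) \<longrightarrow> u x = u y) \<and>
    (\<forall>i<j. \<forall>x v w. u (x(i := v + w)) = u (x(i := v)) + u (x(i := w))) \<and>
    (\<forall>i<j. \<forall>x c v. u (x(i := c *\<^sub>C v)) = c *\<^sub>C u (x(i := v))) \<and>
    continuous_on UNIV u"

definition homogeneous_polynomial ::
    "nat \<Rightarrow> ('a::complex_banach \<Rightarrow> 'b::complex_banach) \<Rightarrow> bool"
  where "homogeneous_polynomial j P \<longleftrightarrow>
    (\<exists>u. continuous_multilinear j u \<and> (\<forall>x. P x = u (\<lambda>i. x)))"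

definition homogeneous_expansion ::
    "('a::complex_banach \<Rightarrow> 'b::complex_banach) \<Rightarrow> (nat \<Rightarrow> 'a \<Rightarrow> 'b) \<Rightarrow> bool"
  where "homogeneous_expansion f P \<longleftrightarrow>
    (\<forall>j. homogeneous_polynomial j (P j)) \<and> (\<forall>z\<in>ball 0 1. (\<lambda>j. P j z) sums f z)"

definition schwarz_map :: "('a::complex_banach \<Rightarrow> 'a) \<Rightarrow> bool"
  where "schwarz_map \<mu> \<longleftrightarrow>
    holomorphic_map_on \<mu> (ball 0 1) \<and> \<mu> ` ball 0 1 \<subseteq> ball 0 1 \<and> \<mu> 0 = 0"

definition zero_of_order ::
    "nat \<Rightarrow> ('a::complex_banach \<Rightarrow> 'b::complex_banach) \<Rightarrow> bool"
  where "zero_of_order k \<mu> \<longleftrightarrow>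
    (\<exists>Q. homogeneous_expansion \<mu> Q \<and> (\<forall>j<k. \<forall>x. Q j x = 0) \<and> (\<exists>x. Q k x \<noteq> 0))"

definition bohr_radius :: "nat \<Rightarrow> real \<Rightarrow> nat \<Rightarrow> real"
  where "bohr_radius k p q = root (q * k) (min p 2 / (2 + min p 2))"

text \<open>The series over \<open>j \<ge> 1\<close> are reindexed from 0. The value is meaningful only if both of them
  converge.\<close>

definition bohr_sum ::
    "nat \<Rightarrow> real \<Rightarrow> nat \<Rightarrow> ('a::complex_banach \<Rightarrow> complex) \<Rightarrow> (nat \<Rightarrow> 'a \<Rightarrow> complex)
      \<Rightarrow> ('a \<Rightarrow> 'a) \<Rightarrow> 'a \<Rightarrow> real"
  where "bohr_sum k p q f P \<mu> z =
    (let a = cmod (f 0); r = norm z in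
      a powr p
      + (\<Sum>j. cmod (P (q * Suc j) (\<mu> z)))
      + (1 / (1 + a) + r ^ (q * k) / (1 - r ^ (q * k)))
        * (\<Sum>j. (cmod (P (q * Suc j) (\<mu> z)))\<^sup>2))"

end

theory Submission
  imports Defs "HOL-Complex_Analysis.Complex_Analysis"
begin

text \<open>On a line through the origin, \<open>f\<close> restricts to a bounded power series on the unit disc,
  so the lower triangular Toeplitz matrix of its coefficients is a contraction, and so is that of
  the subsequence \<open>c\<^sub>j\<close> of the coefficients of degree \<open>q j\<close>. Testing the contraction on suitable
  vectors yields Carlson's bounds for \<open>\<bar>c\<^sub>n\<bar>\<close> in terms of \<open>\<bar>c\<^sub>0\<bar>, \<dots>, \<bar>c\<^sub>m\<bar>\<close> with \<open>m \<le> n / 2\<close>;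
  multiplied by \<open>x\<^sup>n\<close> and summed, they bound the two series by \<open>(1 - a\<^sup>2) x / (1 - x)\<close>. The
  Schwarz lemma \<open>\<parallel>\<mu> z\<parallel> \<le> \<parallel>z\<parallel>\<^sup>k\<close> then allows \<open>x = r\<^bsup>qk\<^esup>\<close>, and Bernoulli's inequality gives the
  radius. For sharpness take a norming functional \<open>\<phi>\<close> with \<open>\<phi> u = 1 = \<parallel>u\<parallel>\<close>, the map
  \<open>\<mu> = \<phi>\<^sup>k u\<close>, and \<open>f = (a - \<phi>\<^sup>q) / (1 - a \<phi>\<^sup>q)\<close> with \<open>a = 0\<close> if \<open>p \<ge> 2\<close> and \<open>a\<close> close
  to 1 otherwise.\<close>

section \<open>Norming functionals\<close>

text \<open>Homogeneity is asked only as an inequality for positive factors, which is quick to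
  verify for \<open>tilt\<close> and for infima; equality and the factor 0 follow in
  \<open>sublinear_scale\<close>.\<close>

definition sublinear :: "('a::real_vector \<Rightarrow> real) \<Rightarrow> bool"
  where "sublinear p \<longleftrightarrow>
    (\<forall>x y. p (x + y) \<le> p x + p y) \<and> (\<forall>t x. 0 < t \<longrightarrow> p (t *\<^sub>R x) \<le> t * p x)"

lemma sublinear_add: "sublinear p \<Longrightarrow> p (x + y) \<le> p x + p y"
  and sublinear_scale_le: "sublinear p \<Longrightarrow> 0 < t \<Longrightarrow> p (t *\<^sub>R x) \<le> t * p x"
  by (auto simp: sublinear_def)

lemma sublinear_0: "sublinear p \<Longrightarrow> p 0 = 0"
  using sublinear_add[of p 0 0] sublinear_scale_le[of p "1/2" 0] by simp

lemma sublinear_scale: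
  assumes "sublinear p" "0 \<le> t"
  shows "p (t *\<^sub>R x) = t * p x"
proof (cases "t = 0")
  case True
  then show ?thesis using sublinear_0[OF assms(1)] by simp
next
  case False
  with assms have t: "t > 0" by simp
  have "p (inverse t *\<^sub>R t *\<^sub>R x) \<le> inverse t * p (t *\<^sub>R x)"
    by (rule sublinear_scale_le) (use assms t in auto)
  then have "t * p x \<le> p (t *\<^sub>R x)" using t by (simp add: field_simps)
  with sublinear_scale_le[OF assms(1) t, of x] show ?thesis by simp
qed

lemma sublinear_neg: "sublinear p \<Longrightarrow> - p (- x) \<le> p x"
  using sublinear_add[of p x "- x"] sublinear_0[of p] by simp

lemma sublinear_norm: "sublinear (norm :: 'a::real_normed_vector \<Rightarrow> real)"
  by (auto simp: sublinear_def norm_triangle_ineq)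

text \<open>Lowers \<open>p\<close> as far as possible in the direction \<open>- x\<close>. A minimal sublinear functional is
  unchanged by every such tilt, and this makes it additive.\<close>

definition tilt :: "('a::real_vector \<Rightarrow> real) \<Rightarrow> 'a \<Rightarrow> 'a \<Rightarrow> real"
  where "tilt p x y = (INF t\<in>{0..}. p (y + t *\<^sub>R x) - t * p x)"

text \<open>Subadditivity at \<open>- y\<close> and \<open>y + t *\<^sub>R x\<close> gives the lower
  bound \<open>- p (- y)\<close>, which is independent of \<open>t\<close>.\<close>

lemma tilt_bdd:
  assumes "sublinear p"
  shows "bdd_below ((\<lambda>t. p (y + t *\<^sub>R x) - t * p x) ` {0..})"
proof (rule bdd_belowI2)
  fix t :: real assume "t \<in> {0..}"
  then have "p (t *\<^sub>R x) = t * p x" using assms by (simp add: sublinear_scale)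
  then show "- p (- y) \<le> p (y + t *\<^sub>R x) - t * p x"
    using sublinear_add[OF assms, of "- y" "y + t *\<^sub>R x"] by simp
qed

lemma tilt_le:
  assumes "sublinear p" "0 \<le> t"
  shows "tilt p x y \<le> p (y + t *\<^sub>R x) - t * p x"
  unfolding tilt_def by (rule cINF_lower[OF tilt_bdd[OF assms(1)]]) (use assms in auto)

lemma tilt_greatest:
  assumes "\<And>t. 0 \<le> t \<Longrightarrow> c \<le> p (y + t *\<^sub>R x) - t * p x"
  shows "c \<le> tilt p x y"
  unfolding tilt_def by (rule cINF_greatest) (use assms in auto)

text \<open>Parameters \<open>t\<close> for \<open>y\<close> and \<open>t'\<close> for
  \<open>y'\<close> combine to \<open>t + t'\<close> for \<open>y + y'\<close>, and \<open>t\<close>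
  for \<open>y\<close> becomes \<open>s * t\<close> for \<open>s *\<^sub>R y\<close>. Taking the
  infimum over one parameter at a time carries both inequalities over from \<open>p\<close>.\<close>

lemma sublinear_tilt:
  assumes p: "sublinear p"
  shows "sublinear (tilt p x)"
  unfolding sublinear_def
proof (intro conjI allI impI)
  fix y y'
  have "tilt p x (y + y') - (p (y + t *\<^sub>R x) - t * p x) \<le> tilt p x y'" if "0 \<le> t" for t
  proof (rule tilt_greatest)
    fix t' :: real assume "0 \<le> t'"
    with that have "tilt p x (y + y') \<le> p ((y + y') + (t + t') *\<^sub>R x) - (t + t') * p x"
      by (intro tilt_le p) auto
    moreover have "p ((y + y') + (t + t') *\<^sub>R x) \<le> p (y + t *\<^sub>R x) + p (y' + t' *\<^sub>R x)"
      using sublinear_add[OF p, of "y + t *\<^sub>R x" "y' + t' *\<^sub>R x"] by (simp add: algebra_simps)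
    ultimately show "tilt p x (y + y') - (p (y + t *\<^sub>R x) - t * p x)
        \<le> p (y' + t' *\<^sub>R x) - t' * p x"
      by (simp add: algebra_simps)
  qed
  then have "tilt p x (y + y') - tilt p x y' \<le> tilt p x y"
    by (intro tilt_greatest) (simp add: algebra_simps)
  then show "tilt p x (y + y') \<le> tilt p x y + tilt p x y'" by simp
next
  fix s :: real and y assume s: "0 < s"
  have "tilt p x (s *\<^sub>R y) / s \<le> tilt p x y"
  proof (rule tilt_greatest)
    fix t :: real assume "0 \<le> t"
    with s have "tilt p x (s *\<^sub>R y) \<le> p (s *\<^sub>R y + (s * t) *\<^sub>R x) - (s * t) * p x"
      by (intro tilt_le p) auto
    also have "s *\<^sub>R y + (s * t) *\<^sub>R x = s *\<^sub>R (y + t *\<^sub>R x)" by (simp add: algebra_simps)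
    also have "p \<dots> = s * p (y + t *\<^sub>R x)" using s p by (simp add: sublinear_scale)
    finally show "tilt p x (s *\<^sub>R y) / s \<le> p (y + t *\<^sub>R x) - t * p x"
      using s by (simp add: field_simps)
  qed
  then show "tilt p x (s *\<^sub>R y) \<le> s * tilt p x y" using s by (simp add: field_simps)
qed

lemma tilt_le_self: "sublinear p \<Longrightarrow> tilt p x y \<le> p y"
  using tilt_le[of p 0 x y] by simp

text \<open>Near-optimal members for \<open>x\<close> and for \<open>y\<close> may differ, but in a
  chain the smaller of the two serves both points, so subadditivity survives the infimum.\<close>

lemma sublinear_INF:
  assumes "C \<noteq> {}" and sub: "\<And>p. p \<in> C \<Longrightarrow> sublinear p"
    and bdd: "\<And>x. bdd_below ((\<lambda>p. p x) ` C)"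
    and chain: "\<And>p p'. p \<in> C \<Longrightarrow> p' \<in> C \<Longrightarrow> p \<le> p' \<or> p' \<le> p"
  shows "sublinear (\<lambda>x. INF p\<in>C. p x)"
  unfolding sublinear_def
proof (intro conjI allI impI)
  fix x y
  let ?u = "\<lambda>x. INF p\<in>C. p x"
  have low: "?u x \<le> p x" if "p \<in> C" for p x by (rule cINF_lower[OF bdd that])
  have *: "?u (x + y) \<le> p x + p' y" if pp: "p \<in> C" "p' \<in> C" for p p'
  proof -
    obtain p'' where p'': "p'' \<in> C" "p'' \<le> p" "p'' \<le> p'"
      using chain[OF pp] pp by blast
    have "?u (x + y) \<le> p'' x + p'' y"
      using low[OF p''(1), of "x + y"] sublinear_add[OF sub[OF p''(1)], of x y] by linarith
    with le_funD[OF p''(2), of x] le_funD[OF p''(3), of y] show ?thesis by linarith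
  qed
  have "?u (x + y) - p x \<le> ?u y" if "p \<in> C" for p
    by (rule cINF_greatest[OF assms(1)]) (use *[OF that] in \<open>simp add: algebra_simps\<close>)
  then have "?u (x + y) - ?u y \<le> ?u x"
    by (intro cINF_greatest[OF assms(1)]) (simp add: algebra_simps)
  then show "?u (x + y) \<le> ?u x + ?u y" by simp
next
  fix t :: real and x assume t: "0 < t"
  have "(INF p\<in>C. p (t *\<^sub>R x)) / t \<le> (INF p\<in>C. p x)"
  proof (rule cINF_greatest[OF assms(1)])
    fix p assume "p \<in> C"
    then show "(INF p\<in>C. p (t *\<^sub>R x)) / t \<le> p x"
      using cINF_lower[OF bdd, of p "t *\<^sub>R x"] sublinear_scale[OF sub, of p t x] t
      by (simp add: field_simps)
  qed
  then show "(INF p\<in>C. p (t *\<^sub>R x)) \<le> t * (INF p\<in>C. p x)" using t by (simp add: field_simps)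
qed

text \<open>Zorn's lemma for the reversed pointwise order on the sublinear functionals below
  \<open>p0\<close>; a chain is bounded by its pointwise infimum.\<close>

lemma minimal_sublinear:
  assumes p0: "sublinear (p0 :: 'a::real_vector \<Rightarrow> real)"
  obtains p where "sublinear p" "p \<le> p0" "\<And>p'. sublinear p' \<Longrightarrow> p' \<le> p \<Longrightarrow> p' = p"
proof -
  define A where "A = {p :: 'a \<Rightarrow> real. sublinear p \<and> p \<le> p0}"
  have "\<exists>m\<in>A. \<forall>a\<in>A. m \<ge> a \<longrightarrow> a = m"
  proof (rule predicate_Zorn)
    show "partial_order_on A (relation_of (\<ge>) A)"
      by (rule partial_order_on_relation_ofI) auto
  next
    fix C assume "C \<in> Chains (relation_of (\<ge>) A)"
    then have C: "C \<subseteq> A" "\<And>p p'. p \<in> C \<Longrightarrow> p' \<in> C \<Longrightarrow> p \<le> p' \<or> p' \<le> p"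
      by (auto simp: Chains_def relation_of_def)
    show "\<exists>u\<in>A. \<forall>a\<in>C. u \<le> a"
    proof (cases "C = {}")
      case True
      then show ?thesis using p0 by (auto simp: A_def)
    next
      case False
      \<comment> \<open>The bound \<open>- p0 (- x)\<close> is common to all members of the chain,
        so the real infimum is a genuine one.\<close>
      have bdd: "bdd_below ((\<lambda>p. p x) ` C)" for x
      proof (rule bdd_belowI2)
        fix p assume "p \<in> C"
        then have "sublinear p" "p \<le> p0" using C by (auto simp: A_def)
        then show "- p0 (- x) \<le> p x"
          using sublinear_neg[of p x] le_funD[of p p0 "- x"] by simp
      qed
      have low: "(\<lambda>x. INF p\<in>C. p x) \<le> p" if "p \<in> C" for p
        by (intro le_funI cINF_lower[OF bdd that])
      have "sublinear (\<lambda>x. INF p\<in>C. p x)"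
        by (rule sublinear_INF) (use False C bdd in \<open>auto simp: A_def\<close>)
      moreover obtain p where "p \<in> C" using False by blast
      with C low have "(\<lambda>x. INF p\<in>C. p x) \<le> p0"
        by (metis (mono_tags, lifting) A_def mem_Collect_eq order_trans subsetD)
      ultimately show ?thesis using low by (auto simp: A_def)
    qed
  qed
  then show ?thesis using that unfolding A_def by (metis (mono_tags, lifting) mem_Collect_eq order_trans)
qed

section \<open>Real and complex norming functionals\<close>

text \<open>A minimal sublinear \<open>p\<close> equals its own tilt in every direction, and the
  parameter 1 in the tilt reverses subadditivity. Starting below the norm tilted along
  \<open>x0\<close> pushes \<open>p (- x0)\<close> down to \<open>- norm x0\<close>, which linearity
  turns into the norming property.\<close>

lemma linear_norming_functional:
  fixes x0 :: "'a::real_normed_vector"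
  obtains g :: "'a \<Rightarrow> real" where "linear g" "\<And>x. g x \<le> norm x" "g x0 = norm x0"
proof -
  obtain p where p: "sublinear p" "p \<le> tilt norm x0"
    and min: "\<And>p'. sublinear p' \<Longrightarrow> p' \<le> p \<Longrightarrow> p' = p"
    using minimal_sublinear[OF sublinear_tilt[OF sublinear_norm]] by blast
  have add: "p (x + y) = p x + p y" for x y
  proof -
    have "tilt p x = p"
      by (rule min) (auto simp: le_fun_def sublinear_tilt tilt_le_self p)
    then have "p y \<le> p (y + 1 *\<^sub>R x) - 1 * p x"
      using tilt_le[OF p(1), of 1 x y] by simp
    with sublinear_add[OF p(1), of x y] show ?thesis by (simp add: add.commute)
  qed
  have neg: "p (- x) = - p x" for x
    using add[of x "- x"] sublinear_0[OF p(1)] by simp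
  have "linear p"
  proof (rule linearI[OF add])
    show "p (t *\<^sub>R x) = t *\<^sub>R p x" for t x
      using sublinear_scale[OF p(1), of t x] sublinear_scale[OF p(1), of "- t" x] neg[of "t *\<^sub>R x"]
      by (cases "0 \<le> t") auto
  qed
  moreover have le: "p x \<le> norm x" for x
    using le_funD[OF p(2), of x] tilt_le_self[OF sublinear_norm, of x0 x] by linarith
  moreover have "p (- x0) \<le> - norm x0"
    using le_funD[OF p(2), of "- x0"] tilt_le[OF sublinear_norm, of 1 x0 "- x0"] by simp
  with neg[of x0] le[of x0] have "p x0 = norm x0" by simp
  ultimately show ?thesis using that by blast
qed

text \<open>The complex-linear functional with real part \<open>g\<close> is
  \<open>g x - \<i> * g (\<i> *\<^sub>C x)\<close>. Rotating \<open>\<phi> x\<close> onto the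
  positive axis reduces its bound to that of \<open>g\<close>; at \<open>x0\<close> the real part
  already has modulus \<open>norm x0\<close>, so the imaginary part vanishes.\<close>

lemma norming_functional:
  fixes x0 :: "'a::complex_banach"
  obtains \<phi> :: "'a \<Rightarrow> complex" where "bounded_linear \<phi>" "\<And>c x. \<phi> (c *\<^sub>C x) = c * \<phi> x"
    "\<And>x. cmod (\<phi> x) \<le> norm x" "\<phi> x0 = of_real (norm x0)"
proof -
  obtain g :: "'a \<Rightarrow> real" where g: "linear g" "\<And>x. g x \<le> norm x" "g x0 = norm x0"
    using linear_norming_functional[of x0] by blast
  interpret linear g by fact
  define \<phi> where "\<phi> x = Complex (g x) (- g (\<i> *\<^sub>C x))" for x
  have decomp: "c *\<^sub>C x = Re c *\<^sub>R x + Im c *\<^sub>R (\<i> *\<^sub>C x)" for c and x :: 'a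
  proof -
    have "c *\<^sub>C x = (of_real (Re c) + of_real (Im c) * \<i>) *\<^sub>C x"
      using complex_eq[of c] by (simp add: mult.commute)
    then show ?thesis by (simp add: scaleC_add_left scaleR_scaleC scaleC_scaleC)
  qed
  have gc: "g (c *\<^sub>C x) = Re c * g x + Im c * g (\<i> *\<^sub>C x)" for c x
    by (subst decomp) (simp add: add scale)
  have \<phi>c: "\<phi> (c *\<^sub>C x) = c * \<phi> x" for c x
    by (rule complex_eqI) (simp_all add: \<phi>_def scaleC_scaleC gc[of c] gc[of "\<i> * c"])
  have \<phi>n: "cmod (\<phi> x) \<le> norm x" for x
  proof (cases "\<phi> x = 0")
    case False
    define c where "c = cnj (\<phi> x) / cmod (\<phi> x)"
    have c: "cmod c = 1" using False by (simp add: c_def norm_divide)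
    have "c * \<phi> x = cmod (\<phi> x)"
      using False by (simp add: c_def mult.commute[of "cnj _"] complex_norm_square[symmetric] power2_eq_square)
    then have "cmod (\<phi> x) = Re (\<phi> (c *\<^sub>C x))" by (simp add: \<phi>c)
    also have "\<dots> \<le> norm (c *\<^sub>C x)" by (simp add: \<phi>_def g)
    finally show ?thesis by (simp add: norm_scaleC c)
  qed auto
  have "bounded_linear \<phi>"
  proof (rule bounded_linear_intro)
    show "\<phi> (x + y) = \<phi> x + \<phi> y" for x y
      by (rule complex_eqI) (simp_all add: \<phi>_def add scaleC_add_right)
    show "\<phi> (t *\<^sub>R x) = t *\<^sub>R \<phi> x" for t x
      by (simp add: scaleR_scaleC[where 'a='a] \<phi>c scaleR_conv_of_real)
    show "norm (\<phi> x) \<le> norm x * 1" for x using \<phi>n by simp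
  qed
  moreover have "\<phi> x0 = of_real (norm x0)"
  proof -
    have re: "Re (\<phi> x0) = norm x0" by (simp add: \<phi>_def g)
    have "(Im (\<phi> x0))\<^sup>2 = (cmod (\<phi> x0))\<^sup>2 - (norm x0)\<^sup>2" using re by (simp add: cmod_power2)
    also have "\<dots> \<le> 0" using \<phi>n[of x0] by (simp add: power_mono)
    finally show ?thesis using re by (simp add: complex_eq_iff)
  qed
  ultimately show ?thesis using that \<phi>c \<phi>n by blast
qed

lemma bounded_linear_scaleC_left: "bounded_linear (\<lambda>c. c *\<^sub>C (d :: 'b::complex_banach))"
proof (rule bounded_linear_intro)
  show "(t *\<^sub>R c) *\<^sub>C d = t *\<^sub>R (c *\<^sub>C d)" for t c
    by (simp add: scaleR_scaleC[where 'a='b] scaleC_scaleC scaleR_conv_of_real)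
  show "norm (c *\<^sub>C d) \<le> norm c * norm d" for c
    by (simp add: norm_scaleC)
qed (simp add: scaleC_add_left)

lemma scaleC_zero_left [simp]: "0 *\<^sub>C x = (0::'a::complex_banach)"
  using scaleC_add_left[of 0 0 x] by simp

lemma scaleC_zero_right [simp]: "c *\<^sub>C 0 = (0::'a::complex_banach)"
  using scaleC_add_right[of c 0 0] by simp

section \<open>Power series bounded on the disc\<close>

text \<open>The symmetry \<open>\<omega> j ^ l = \<omega> l ^ j\<close> makes this a geometric sum
  whose ratio is an \<open>N\<close>-th root of unity, different from 1 when
  \<open>l \<noteq> m\<close>.\<close>

lemma sum_roots_unity_orthogonal:
  fixes l m N :: nat
  assumes "l < N" "m < N"
  defines "\<omega> \<equiv> \<lambda>j::nat. cis (2 * pi * j / N)"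
  shows "(\<Sum>j<N. \<omega> j ^ l * cnj (\<omega> j) ^ m) = (if l = m then of_nat N else 0)"
proof -
  have pow: "\<omega> j ^ l = \<omega> l ^ j" for j l
    unfolding \<omega>_def Complex.DeMoivre by (rule arg_cong[of _ _ cis]) simp
  define x where "x = \<omega> l * cnj (\<omega> m)"
  have unit: "\<omega> j * cnj (\<omega> j) = 1" for j
    by (simp add: \<omega>_def cis_cnj cis_mult)
  have "(\<Sum>j<N. \<omega> j ^ l * cnj (\<omega> j) ^ m) = (\<Sum>j<N. x ^ j)"
    by (simp add: x_def power_mult_distrib pow flip: complex_cnj_power)
  also have "\<dots> = (if l = m then of_nat N else 0)"
  proof (cases "l = m")
    case True
    then show ?thesis by (simp add: x_def unit)
  next
    case False
    have "x \<noteq> 1"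
    proof
      assume "x = 1"
      then have "\<omega> l = \<omega> m"
        using unit[of m] unfolding x_def
        by (metis (no_types, lifting) mult.assoc mult.commute mult.right_neutral)
      moreover have "inj_on \<omega> {..<N}"
        using bij_betw_imp_inj_on[OF Complex.bij_betw_roots_unity[of N]] assms by (simp add: \<omega>_def)
      ultimately show False using assms False by (auto dest: inj_onD)
    qed
    moreover have "\<omega> j ^ N = 1" for j
    proof -
      have "real N * (2 * pi * j / N) = 2 * pi * j" using assms by simp
      then show ?thesis by (simp add: \<omega>_def Complex.DeMoivre cis_multiple_2pi)
    qed
    then have "x ^ N = 1" by (simp add: x_def power_mult_distrib flip: complex_cnj_power)
    ultimately show ?thesis using False by (simp add: geometric_sum)
  qed
  finally show ?thesis .
qed

text \<open>Orthogonality leaves only the diagonal of the expanded squares. Averages over roots of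
  unity take the place of integrals over the circle.\<close>

lemma discrete_parseval:
  fixes g :: "nat \<Rightarrow> complex"
  shows "(\<Sum>j<N. (cmod (\<Sum>l<N. g l * cis (2 * pi * real j / real N) ^ l))\<^sup>2)
    = real N * (\<Sum>l<N. (cmod (g l))\<^sup>2)"
proof -
  define \<omega> where "\<omega> j = cis (2 * pi * real j / real N)" for j :: nat
  have "complex_of_real (\<Sum>j<N. (cmod (\<Sum>l<N. g l * \<omega> j ^ l))\<^sup>2)
      = (\<Sum>j<N. \<Sum>l<N. \<Sum>m<N. (g l * cnj (g m)) * (\<omega> j ^ l * cnj (\<omega> j) ^ m))"
    unfolding of_real_sum complex_norm_square cnj_sum sum_product
    by (simp add: mult_ac)
  also have "\<dots> = (\<Sum>l<N. \<Sum>m<N. \<Sum>j<N. (g l * cnj (g m)) * (\<omega> j ^ l * cnj (\<omega> j) ^ m))"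
    by (subst sum.swap, rule sum.cong[OF refl], subst sum.swap, rule refl)
  also have "\<dots> = (\<Sum>l<N. \<Sum>m<N. (g l * cnj (g m)) * (if l = m then of_nat N else 0))"
    by (intro sum.cong refl, subst sum_distrib_left[symmetric], subst \<omega>_def, subst \<omega>_def,
        subst sum_roots_unity_orthogonal) auto
  also have "\<dots> = complex_of_real (real N * (\<Sum>l<N. (cmod (g l))\<^sup>2))"
    by (simp add: if_distrib[of "\<lambda>x. _ * x"] complex_norm_square sum_distrib_left mult_ac
        flip: of_real_power cong: if_cong)
  finally show ?thesis unfolding \<omega>_def of_real_eq_iff .
qed

section \<open>Toeplitz contractions from Schur functions\<close>

text \<open>Taylor coefficients of the Schur class, the holomorphic functions from the unit disc to
  the closed unit disc.\<close>

definition schur_coeffs :: "(nat \<Rightarrow> complex) \<Rightarrow> bool"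
  where "schur_coeffs b \<longleftrightarrow>
    (\<forall>z. cmod z < 1 \<longrightarrow> (\<exists>s. (\<lambda>n. b n * z ^ n) sums s \<and> cmod s \<le> 1))"

text \<open>The inner sum is row \<open>m\<close> of the lower triangular Toeplitz matrix of
  \<open>c\<close> applied to \<open>h\<close>, that is, coefficient \<open>m\<close> of a product
  of power series. Every finite section of the matrix is to be a contraction in the Euclidean
  norm.\<close>

definition contractive :: "(nat \<Rightarrow> complex) \<Rightarrow> bool"
  where "contractive c \<longleftrightarrow>
    (\<forall>M h. (\<Sum>m\<le>M. (cmod (\<Sum>i\<le>m. h i * c (m - i)))\<^sup>2) \<le> (\<Sum>i\<le>M. (cmod (h i))\<^sup>2))"

lemma schur_coeffs_summable_norm:
  assumes "schur_coeffs b" "cmod z < 1"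
  shows "summable (\<lambda>n. cmod (b n * z ^ n))"
proof -
  obtain r where r: "cmod z < r" "r < 1" using assms dense by blast
  then have "cmod (of_real r) < 1" "cmod z < cmod (of_real r)"
    using norm_ge_zero[of z] by (simp_all del: norm_ge_zero)
  then show ?thesis
    using assms(1) powser_insidea[of b "of_real r" z] unfolding schur_coeffs_def
    by (meson sums_summable)
qed

text \<open>Multiplying the polynomial \<open>H\<close> with coefficients \<open>h\<close> by a
  Schur function does not increase its modulus on the circle of radius \<open>\<rho>\<close>.
  Parseval on \<open>N\<close> points compares the coefficients of the truncated product with those
  of \<open>H\<close>, and the truncation error disappears as \<open>N\<close> grows.\<close>

lemma contractive_circle:
  fixes h :: "nat \<Rightarrow> complex"
  assumes b: "schur_coeffs b" and \<rho>: "0 < \<rho>" "\<rho> < 1"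
  shows "(\<Sum>m\<le>M. (cmod ((\<Sum>i\<le>m. h i * b (m - i)) * of_real \<rho> ^ m))\<^sup>2)
    \<le> (\<Sum>i\<le>M. (cmod (h i * of_real \<rho> ^ i))\<^sup>2)"
proof -
  \<comment> \<open>Padding by zeros turns \<open>h\<close> into a full sequence, so that the Cauchy
    product applies; rows up to \<open>M\<close> are unaffected.\<close>
  define h' where "h' i = (if i \<le> M then h i else 0)" for i
  define g where "g m = (\<Sum>i\<le>m. h' i * b (m - i))" for m
  define H where "H z = (\<Sum>i\<le>M. h i * z ^ i)" for z
  have h'sums: "(\<lambda>i. h' i * z ^ i) sums H z" for z
  proof -
    have "(\<lambda>i. h' i * z ^ i) sums (\<Sum>i\<le>M. h' i * z ^ i)"
      by (rule sums_finite) (auto simp: h'_def)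
    then show ?thesis by (simp add: H_def h'_def)
  qed
  have h'abs: "summable (\<lambda>i. cmod (h' i * z ^ i))" for z
    by (rule summable_finite[of "{..M}"]) (auto simp: h'_def)
  have gprod: "(\<Sum>i\<le>m. (h' i * z ^ i) * (b (m - i) * z ^ (m - i))) = g m * z ^ m" for m z
    unfolding g_def sum_distrib_right
    by (intro sum.cong refl) (simp add: mult_ac flip: power_add)
  have gabs: "summable (\<lambda>m. cmod (g m * z ^ m))" if "cmod z < 1" for z
  proof -
    have "summable (\<lambda>m. \<Sum>i\<le>m. cmod (h' i * z ^ i) * cmod (b (m - i) * z ^ (m - i)))"
      using summable_Cauchy_product[of "\<lambda>i. cmod (h' i * z ^ i)" "\<lambda>i. cmod (b i * z ^ i)"]
        h'abs[of z] schur_coeffs_summable_norm[OF b that] by simp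
    then show ?thesis
    proof (rule summable_comparison_test[rotated], intro exI allI impI)
      fix m
      show "norm (cmod (g m * z ^ m))
          \<le> (\<Sum>i\<le>m. cmod (h' i * z ^ i) * cmod (b (m - i) * z ^ (m - i)))"
        unfolding gprod[symmetric] norm_mult[symmetric] by (simp add: sum_norm_le)
    qed
  qed
  have gbound: "cmod (\<Sum>m. g m * z ^ m) \<le> cmod (H z)" if z1: "cmod z < 1" for z
  proof -
    obtain s where s: "(\<lambda>n. b n * z ^ n) sums s" "cmod s \<le> 1"
      using b z1 unfolding schur_coeffs_def by blast
    have "(\<lambda>m. g m * z ^ m) sums (H z * s)"
      using Cauchy_product_sums[OF h'abs[of z] schur_coeffs_summable_norm[OF b z1]]
      by (simp add: gprod sums_unique[OF h'sums, symmetric] sums_unique[OF s(1), symmetric])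
    then show ?thesis
      using mult_left_le[OF s(2), of "cmod (H z)"] by (simp add: sums_iff norm_mult)
  qed
  \<comment> \<open>A tail of the absolutely convergent series at \<open>\<rho>\<close>: it bounds
    the truncation error uniformly on the circle.\<close>
  define \<epsilon> where "\<epsilon> N = (\<Sum>m. cmod (g m * of_real \<rho> ^ m)) - (\<Sum>m<N. cmod (g m * of_real \<rho> ^ m))" for N
  have \<rho>1: "cmod (of_real \<rho>) < 1" using \<rho> by simp
  have \<epsilon>0: "\<epsilon> \<longlonglongrightarrow> 0"
    using tendsto_diff[OF tendsto_const summable_LIMSEQ[OF gabs[OF \<rho>1]],
        of "\<Sum>m. cmod (g m * of_real \<rho> ^ m)"] by (simp add: \<epsilon>_def[abs_def])
  have trunc: "cmod (\<Sum>m<N. g m * z ^ m) \<le> cmod (H z) + \<epsilon> N" if z: "cmod z = \<rho>" for z N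
  proof -
    have z1: "cmod z < 1" using z \<rho> by simp
    have gz: "cmod (g m * z ^ m) = cmod (g m * of_real \<rho> ^ m)" for m
      using z \<rho> by (simp add: norm_mult norm_power)
    have sm: "summable (\<lambda>m. g m * z ^ m)" by (rule summable_norm_cancel[OF gabs[OF z1]])
    have "cmod (\<Sum>m. g (m + N) * z ^ (m + N)) \<le> (\<Sum>m. cmod (g (m + N) * z ^ (m + N)))"
      using gabs[OF z1] by (intro summable_norm) (simp only: summable_iff_shift[of "\<lambda>m. cmod (g m * z ^ m)" N])
    also have "\<dots> = \<epsilon> N"
      using suminf_minus_initial_segment[OF gabs[OF z1], of N] by (simp only: \<epsilon>_def gz)
    finally have tail: "cmod (\<Sum>m. g (m + N) * z ^ (m + N)) \<le> \<epsilon> N" .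
    have "(\<Sum>m<N. g m * z ^ m) = (\<Sum>m. g m * z ^ m) - (\<Sum>m. g (m + N) * z ^ (m + N))"
      using suminf_minus_initial_segment[OF sm, of N] by simp
    then have "cmod (\<Sum>m<N. g m * z ^ m)
        \<le> cmod (\<Sum>m. g m * z ^ m) + cmod (\<Sum>m. g (m + N) * z ^ (m + N))"
      by (simp add: norm_triangle_ineq4)
    with tail gbound[OF z1] show ?thesis by linarith
  qed
  \<comment> \<open>A bound for \<open>H\<close> on the circle that does not depend on
    \<open>N\<close>, so that the cross term \<open>2 * C * \<epsilon> N\<close> tends to 0.\<close>
  define C where "C = (\<Sum>i\<le>M. cmod (h i))"
  have HC: "cmod (H z) \<le> C" if "cmod z = \<rho>" for z
    unfolding H_def C_def
    by (rule sum_norm_le) (use that \<rho> in \<open>simp add: norm_mult norm_power mult_left_le power_le_one\<close>)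
  \<comment> \<open>For \<open>N > M\<close> all coefficients of \<open>H\<close> have index below
    \<open>N\<close>, so the discrete Parseval identity is exact for \<open>H\<close>.\<close>
  have main: "(\<Sum>m\<le>M. (cmod (g m * of_real \<rho> ^ m))\<^sup>2)
      \<le> (\<Sum>i\<le>M. (cmod (h i * of_real \<rho> ^ i))\<^sup>2) + 2 * C * \<epsilon> N + (\<epsilon> N)\<^sup>2" if N: "N > M" for N
  proof -
    define z where "z j = of_real \<rho> * cis (2 * pi * real j / real N)" for j :: nat
    have zn: "cmod (z j) = \<rho>" for j using \<rho> by (simp add: z_def norm_mult)
    have \<epsilon>pos: "\<epsilon> N \<ge> 0"
      using sum_le_suminf[OF gabs[OF \<rho>1], of "{..<N}"] by (simp add: \<epsilon>_def)
    have pars: "(\<Sum>j<N. (cmod (\<Sum>l<N. c l * z j ^ l))\<^sup>2)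
        = real N * (\<Sum>l<N. (cmod (c l * of_real \<rho> ^ l))\<^sup>2)" for c :: "nat \<Rightarrow> complex"
      using discrete_parseval[of "\<lambda>l. c l * of_real \<rho> ^ l" N]
      by (simp add: z_def power_mult_distrib mult_ac)
    have HN: "H z = (\<Sum>l<N. h' l * z ^ l)" for z
      unfolding H_def by (rule sum.mono_neutral_cong_left) (use N in \<open>auto simp: h'_def\<close>)
    have h'N: "(\<Sum>l<N. (cmod (h' l * of_real \<rho> ^ l))\<^sup>2) = (\<Sum>i\<le>M. (cmod (h i * of_real \<rho> ^ i))\<^sup>2)"
      by (rule sum.mono_neutral_cong_right) (use N in \<open>auto simp: h'_def\<close>)
    have "real N * (\<Sum>m\<le>M. (cmod (g m * of_real \<rho> ^ m))\<^sup>2)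
        \<le> real N * (\<Sum>m<N. (cmod (g m * of_real \<rho> ^ m))\<^sup>2)"
      by (intro mult_left_mono sum_mono2) (use N in auto)
    also have "\<dots> = (\<Sum>j<N. (cmod (\<Sum>l<N. g l * z j ^ l))\<^sup>2)" by (rule pars[symmetric])
    also have "\<dots> \<le> (\<Sum>j<N. (cmod (H (z j)))\<^sup>2 + (2 * C * \<epsilon> N + (\<epsilon> N)\<^sup>2))"
    proof (rule sum_mono)
      fix j
      have "(cmod (\<Sum>l<N. g l * z j ^ l))\<^sup>2 \<le> (cmod (H (z j)) + \<epsilon> N)\<^sup>2"
        by (intro power_mono trunc zn) auto
      also have "\<dots> = (cmod (H (z j)))\<^sup>2 + (2 * cmod (H (z j)) * \<epsilon> N + (\<epsilon> N)\<^sup>2)"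
        by (simp add: power2_sum)
      also have "\<dots> \<le> (cmod (H (z j)))\<^sup>2 + (2 * C * \<epsilon> N + (\<epsilon> N)\<^sup>2)"
        using mult_right_mono[OF HC[OF zn[of j]] \<epsilon>pos] by simp
      finally show "(cmod (\<Sum>l<N. g l * z j ^ l))\<^sup>2
          \<le> (cmod (H (z j)))\<^sup>2 + (2 * C * \<epsilon> N + (\<epsilon> N)\<^sup>2)" .
    qed
    also have "\<dots> = real N * ((\<Sum>i\<le>M. (cmod (h i * of_real \<rho> ^ i))\<^sup>2) + 2 * C * \<epsilon> N + (\<epsilon> N)\<^sup>2)"
      by (simp add: sum.distrib HN pars h'N algebra_simps)
    finally show ?thesis using N by simp
  qed
  have "(\<lambda>N. (\<Sum>i\<le>M. (cmod (h i * of_real \<rho> ^ i))\<^sup>2) + 2 * C * \<epsilon> N + (\<epsilon> N)\<^sup>2)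
      \<longlonglongrightarrow> (\<Sum>i\<le>M. (cmod (h i * of_real \<rho> ^ i))\<^sup>2) + 2 * C * 0 + 0\<^sup>2"
    by (intro tendsto_intros \<epsilon>0)
  then have "(\<Sum>m\<le>M. (cmod (g m * of_real \<rho> ^ m))\<^sup>2) \<le> (\<Sum>i\<le>M. (cmod (h i * of_real \<rho> ^ i))\<^sup>2)"
    by (intro LIMSEQ_le_const[where X = "\<lambda>N. (\<Sum>i\<le>M. (cmod (h i * of_real \<rho> ^ i))\<^sup>2) + 2 * C * \<epsilon> N + (\<epsilon> N)\<^sup>2"])
      (auto intro!: exI[of _ "Suc M"] main)
  moreover have "g m = (\<Sum>i\<le>m. h i * b (m - i))" if "m \<le> M" for m
    unfolding g_def by (intro sum.cong) (use that in \<open>auto simp: h'_def\<close>)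
  ultimately show ?thesis by simp
qed

text \<open>Limit \<open>\<rho> \<rightarrow> 1\<close> from the left in
  \<open>contractive_circle\<close>, after dropping the weights, which are at most 1, on the
  right-hand side.\<close>

lemma schur_coeffs_contractive:
  assumes "schur_coeffs b"
  shows "contractive b"
  unfolding contractive_def
proof (intro allI)
  fix M and h :: "nat \<Rightarrow> complex"
  define g where "g m = (\<Sum>i\<le>m. h i * b (m - i))" for m
  have "(\<Sum>m\<le>M. (cmod (g m * of_real \<rho> ^ m))\<^sup>2) \<le> (\<Sum>i\<le>M. (cmod (h i))\<^sup>2)"
    if \<rho>: "0 < \<rho>" "\<rho> < 1" for \<rho>
  proof -
    have "(\<Sum>m\<le>M. (cmod (g m * of_real \<rho> ^ m))\<^sup>2) \<le> (\<Sum>i\<le>M. (cmod (h i * of_real \<rho> ^ i))\<^sup>2)"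
      unfolding g_def by (rule contractive_circle[OF assms \<rho>])
    also have "\<dots> \<le> (\<Sum>i\<le>M. (cmod (h i))\<^sup>2)"
      by (intro sum_mono power_mono)
        (use \<rho> in \<open>auto simp: norm_mult norm_power mult_left_le power_le_one\<close>)
    finally show ?thesis .
  qed
  then have ev: "\<forall>\<^sub>F \<rho> in at_left 1.
      (\<Sum>m\<le>M. (cmod (g m * of_real \<rho> ^ m))\<^sup>2) \<le> (\<Sum>i\<le>M. (cmod (h i))\<^sup>2)"
    by (intro eventually_at_leftI[of 0]) auto
  have "((\<lambda>\<rho>::real. \<Sum>m\<le>M. (cmod (g m * of_real \<rho> ^ m))\<^sup>2)
      \<longlongrightarrow> (\<Sum>m\<le>M. (cmod (g m * of_real 1 ^ m))\<^sup>2)) (at_left 1)"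
    by (intro tendsto_intros)
  then show "(\<Sum>m\<le>M. (cmod (\<Sum>i\<le>m. h i * b (m - i)))\<^sup>2) \<le> (\<Sum>i\<le>M. (cmod (h i))\<^sup>2)"
    using tendsto_upperbound[OF _ ev] by (simp add: g_def)
qed

text \<open>Spreading \<open>h\<close> over the multiples of \<open>q\<close> makes row
  \<open>q * m\<close> of the original matrix reproduce row \<open>m\<close> of the new one; the
  remaining rows only add nonnegative terms.\<close>

lemma contractive_section:
  assumes b: "contractive b" and "q \<ge> 1"
  shows "contractive (\<lambda>j. b (q * j))"
  unfolding contractive_def
proof (intro allI)
  fix M and h :: "nat \<Rightarrow> complex"
  define h' where "h' l = (if q dvd l then h (l div q) else 0)" for l
  have inj: "inj_on ((*) q) A" for A using assms by (auto simp: inj_on_def)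
  have reindex: "(\<Sum>l\<le>q * m. F l) = (\<Sum>i\<le>m. F (q * i))"
    if "\<And>l. \<not> q dvd l \<Longrightarrow> F l = 0" for m and F :: "nat \<Rightarrow> 'b::comm_monoid_add"
  proof -
    have "(\<Sum>i\<le>m. F (q * i)) = (\<Sum>l\<in>(*) q ` {..m}. F l)" by (simp add: sum.reindex[OF inj])
    also have "\<dots> = (\<Sum>l\<le>q * m. F l)"
    proof (rule sum.mono_neutral_left)
      show "\<forall>l\<in>{..q * m} - (*) q ` {..m}. F l = 0"
      proof
        fix l assume "l \<in> {..q * m} - (*) q ` {..m}"
        then have "\<not> q dvd l" using assms(2) by (auto elim!: dvdE)
        then show "F l = 0" by (rule that)
      qed
    qed auto
    finally show ?thesis by simp
  qed
  have conv: "(\<Sum>i\<le>q * m. h' i * b (q * m - i)) = (\<Sum>i\<le>m. h i * b (q * (m - i)))" for m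
    using assms by (subst reindex) (auto simp: h'_def right_diff_distrib')
  have "(\<Sum>m\<le>M. (cmod (\<Sum>i\<le>m. h i * b (q * (m - i))))\<^sup>2)
      = (\<Sum>l\<in>(*) q ` {..M}. (cmod (\<Sum>i\<le>l. h' i * b (l - i)))\<^sup>2)"
    by (simp add: sum.reindex[OF inj] conv)
  also have "\<dots> \<le> (\<Sum>l\<le>q * M. (cmod (\<Sum>i\<le>l. h' i * b (l - i)))\<^sup>2)"
    by (rule sum_mono2) auto
  also have "\<dots> \<le> (\<Sum>l\<le>q * M. (cmod (h' l))\<^sup>2)" using b unfolding contractive_def by blast
  also have "\<dots> = (\<Sum>i\<le>M. (cmod (h i))\<^sup>2)"
    using assms by (subst reindex) (auto simp: h'_def)
  finally show "(\<Sum>m\<le>M. (cmod (\<Sum>i\<le>m. h i * b (q * (m - i))))\<^sup>2) \<le> (\<Sum>i\<le>M. (cmod (h i))\<^sup>2)" .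
qed

section \<open>Carlson's coefficient inequalities\<close>

text \<open>Only the rows below \<open>s\<close> and the rows \<open>s\<close> and \<open>N\<close>
  of the contraction are kept. The case \<open>s = 0\<close> needs \<open>w = 0\<close>, since the
  entries 1 and \<open>w\<close> of the test vector would otherwise share index 0.\<close>

lemma contractive_test:
  fixes w \<kappa> :: complex
  assumes c: "contractive c" and "s < N" and w: "s = 0 \<Longrightarrow> w = 0"
  defines "S \<equiv> \<Sum>k<N - s. (cmod (c k))\<^sup>2"
  shows "(\<Sum>m<s. (cmod (c m))\<^sup>2) + (cmod (c s + w * c 0))\<^sup>2
      + (cmod (c N + w * c (N - s) + \<kappa> * S))\<^sup>2
    \<le> 1 + (cmod w)\<^sup>2 + (cmod \<kappa>)\<^sup>2 * S"
proof -
  \<comment> \<open>The reversed conjugate coefficients beyond \<open>s\<close> meet the matching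
    coefficients in row \<open>N\<close> and add up to \<open>\<kappa> * S\<close> there; they do
    not touch the rows up to \<open>s\<close>.\<close>
  define h where "h i = (if i = 0 then 1 else 0) + (if i = s then w else 0)
    + (if i > s then \<kappa> * cnj (c (N - i)) else 0)" for i
  define g where "g m = (\<Sum>i\<le>m. h i * c (m - i))" for m
  have g: "g m = c m + (if s \<le> m then w * c (m - s) else 0)
      + (\<Sum>i\<le>m. if i > s then \<kappa> * cnj (c (N - i)) * c (m - i) else 0)" for m
    unfolding g_def h_def distrib_right sum.distrib
    by (simp add: if_distrib[of "\<lambda>x. x * _"] cong: if_cong)
  have flip: "(\<Sum>i\<le>N. if i > s then F (N - i) else 0) = (\<Sum>k<N - s. F k)"
    for F :: "nat \<Rightarrow> 'b::comm_monoid_add"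
  proof -
    have "(\<Sum>i\<le>N. if i > s then F (N - i) else 0) = (\<Sum>i\<in>{s<..N}. F (N - i))"
      by (rule sum.mono_neutral_cong_right) auto
    also have "\<dots> = (\<Sum>k<N - s. F k)"
      by (rule sum.reindex_bij_witness[of _ "\<lambda>k. N - k" "\<lambda>i. N - i"]) auto
    finally show ?thesis .
  qed
  have "(\<Sum>m<s. (cmod (c m))\<^sup>2) = (\<Sum>m<s. (cmod (g m))\<^sup>2)"
    by (intro sum.cong refl) (auto simp: g intro!: sum.neutral)
  moreover have "g s = c s + w * c 0" by (simp add: g)
  moreover have "g N = c N + w * c (N - s) + \<kappa> * S"
    using \<open>s < N\<close> flip[of "\<lambda>k. \<kappa> * cnj (c k) * c k"]
    by (simp add: g S_def sum_distrib_left complex_norm_square mult_ac cong: if_cong flip: of_real_power)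
  ultimately have "(\<Sum>m<s. (cmod (c m))\<^sup>2) + (cmod (c s + w * c 0))\<^sup>2
      + (cmod (c N + w * c (N - s) + \<kappa> * S))\<^sup>2 = (\<Sum>m\<in>{..<s} \<union> {s, N}. (cmod (g m))\<^sup>2)"
    using \<open>s < N\<close> by (subst sum.union_disjoint) auto
  also have "\<dots> \<le> (\<Sum>m\<le>N. (cmod (g m))\<^sup>2)" by (rule sum_mono2) (use \<open>s < N\<close> in auto)
  also have "\<dots> \<le> (\<Sum>i\<le>N. (cmod (h i))\<^sup>2)"
    using c unfolding contractive_def g_def by blast
  also have "\<dots> = (\<Sum>i\<le>N. (if i = 0 then 1 else 0) + (if i = s then (cmod w)\<^sup>2 else 0)
      + (if i > s then (cmod \<kappa>)\<^sup>2 * (cmod (c (N - i)))\<^sup>2 else 0))"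
    by (intro sum.cong refl) (use w in \<open>auto simp: h_def norm_mult power_mult_distrib\<close>)
  also have "\<dots> = 1 + (cmod w)\<^sup>2 + (cmod \<kappa>)\<^sup>2 * S"
    using \<open>s < N\<close> by (simp add: sum.distrib flip[of "\<lambda>k. (cmod \<kappa>)\<^sup>2 * (cmod (c k))\<^sup>2"] S_def sum_distrib_left)
  finally show ?thesis .
qed

text \<open>The parameter \<open>\<kappa>\<close> is free: 0 yields \<open>S \<le> 1\<close>, and
  \<open>\<sigma>\<close> itself forces \<open>\<sigma> = 0\<close> when
  \<open>S = 1\<close>.\<close>

lemma norm_le_one_minus:
  fixes \<sigma> :: complex
  assumes "\<And>\<kappa>. S + (cmod (\<sigma> + \<kappa> * of_real S))\<^sup>2 \<le> 1 + (cmod \<kappa>)\<^sup>2 * S"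
  shows "cmod \<sigma> \<le> 1 - S"
proof -
  have S1: "S \<le> 1" using assms[of 0] by (simp add: add_increasing2) (smt (verit) zero_le_power2)
  show ?thesis
  proof (cases "S = 1")
    case True
    have "(cmod (2 * \<sigma>))\<^sup>2 \<le> (cmod \<sigma>)\<^sup>2" using assms[of \<sigma>] True by (simp flip: mult_2)
    then show ?thesis using True by (simp add: norm_mult power_mult_distrib)
  next
    case False
    with S1 have d: "1 - S > 0" by simp
    \<comment> \<open>The fixed point of \<open>\<kappa> \<mapsto> \<sigma> + \<kappa> * S\<close>,
      which reduces the hypothesis to \<open>cmod \<kappa> \<le> 1\<close>.\<close>
    define \<kappa> where "\<kappa> = \<sigma> / of_real (1 - S)"
    have "\<sigma> + \<kappa> * of_real S = \<kappa>"
    proof -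
      have "\<sigma> = \<kappa> * of_real (1 - S)" using d by (simp add: \<kappa>_def del: of_real_diff)
      then show ?thesis by (simp add: algebra_simps)
    qed
    with assms[of \<kappa>] have "(cmod \<kappa>)\<^sup>2 * (1 - S) \<le> 1 * (1 - S)" by (simp add: algebra_simps)
    then have "(cmod \<kappa>)\<^sup>2 \<le> 1" using d mult_le_cancel_right_pos by blast
    then have "cmod \<kappa> \<le> 1" by (simp add: power_le_one_iff abs_square_le_1)
    moreover have "cmod \<kappa> = cmod \<sigma> / (1 - S)" using d by (simp add: \<kappa>_def norm_divide del: of_real_diff)
    ultimately show ?thesis using d by simp
  qed
qed

text \<open>With \<open>s = n\<close>, \<open>N = 2 * n + 1\<close> and \<open>w = 0\<close>, the
  kept rows up to \<open>n\<close> and the mass \<open>S\<close> both equal the sum of squares up to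
  \<open>n\<close>, as \<open>norm_le_one_minus\<close> requires.\<close>

lemma carlson_odd:
  assumes "contractive c"
  shows "cmod (c (2 * n + 1)) \<le> 1 - (\<Sum>k\<le>n. (cmod (c k))\<^sup>2)"
proof (rule norm_le_one_minus)
  fix \<kappa>
  show "(\<Sum>k\<le>n. (cmod (c k))\<^sup>2)
      + (cmod (c (2 * n + 1) + \<kappa> * of_real (\<Sum>k\<le>n. (cmod (c k))\<^sup>2)))\<^sup>2
    \<le> 1 + (cmod \<kappa>)\<^sup>2 * (\<Sum>k\<le>n. (cmod (c k))\<^sup>2)"
    using contractive_test[OF assms, of n "2 * n + 1" 0 \<kappa>]
    by (simp add: lessThan_Suc_atMost[symmetric])
qed

text \<open>With \<open>s = n\<close> and \<open>N = 2 * n\<close> both sums of squares stop before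
  \<open>n\<close>; the middle coefficient enters through \<open>w\<close>.\<close>

lemma carlson_even:
  assumes c: "contractive c" and n: "n \<ge> 1"
  shows "cmod (c (2 * n))
    \<le> 1 - (\<Sum>k<n. (cmod (c k))\<^sup>2) - (cmod (c n))\<^sup>2 / (1 + cmod (c 0))"
proof -
  define a where "a = cmod (c 0)"
  define t where "t = c (2 * n)"
  \<comment> \<open>\<open>sgn t\<close> would be 0 at \<open>t = 0\<close>; the default 1 keeps
    \<open>u\<close> a unit phase.\<close>
  define u where "u = (if t = 0 then 1 else sgn t)"
  have u: "cmod u = 1" "t = of_real (cmod t) * u"
    by (auto simp: u_def norm_sgn) (simp add: sgn_eq)
  have a: "1 + a > 0" by (simp add: a_def add_pos_nonneg)
  \<comment> \<open>The phase of \<open>w\<close> aligns \<open>w c\<^sub>n\<close> with \<open>c\<^bsub>2n\<^esub>\<close>; its modulus is the one at which the terms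
    \<open>\<bar>w\<bar>\<^sup>2\<close> and \<open>\<bar>c\<^sub>n + w c\<^sub>0\<bar>\<^sup>2\<close> of \<open>contractive_test\<close> balance in the worst case.\<close>
  define w where "w = u * cnj (c n) / of_real (1 + a)"
  have wn: "cmod w = cmod (c n) / (1 + a)"
    using a u by (simp add: w_def norm_mult norm_divide del: of_real_add)
  define \<sigma> where "\<sigma> = t + w * c n"
  have "w * c n = u * of_real ((cmod (c n))\<^sup>2 / (1 + a))"
    by (simp add: w_def complex_norm_square mult_ac flip: of_real_power)
  then have "\<sigma> = u * of_real (cmod t + (cmod (c n))\<^sup>2 / (1 + a))"
    unfolding \<sigma>_def by (subst u(2)) (simp add: algebra_simps)
  then have \<sigma>n: "cmod \<sigma> = cmod t + (cmod (c n))\<^sup>2 / (1 + a)"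
    using u a by (simp add: norm_mult del: of_real_add)
  \<comment> \<open>The modulus of \<open>w\<close> satisfies
    \<open>(1 + a) * cmod w = cmod (c n)\<close>, so row \<open>n\<close> pays for the cost
    \<open>(cmod w)\<^sup>2\<close> of the extra entry.\<close>
  have "cmod w = cmod (c n) - cmod (w * c 0)"
    using a by (simp add: wn norm_mult a_def[symmetric] field_simps)
  also have "\<dots> \<le> cmod (c n + w * c 0)" by (rule norm_diff_ineq)
  finally have w_le: "(cmod w)\<^sup>2 \<le> (cmod (c n + w * c 0))\<^sup>2" by (simp add: power_mono)
  have "cmod \<sigma> \<le> 1 - (\<Sum>k<n. (cmod (c k))\<^sup>2)"
  proof (rule norm_le_one_minus)
    fix \<kappa>
    have "(\<Sum>k<n. (cmod (c k))\<^sup>2) + (cmod (c n + w * c 0))\<^sup>2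
        + (cmod (\<sigma> + \<kappa> * of_real (\<Sum>k<n. (cmod (c k))\<^sup>2)))\<^sup>2
      \<le> 1 + (cmod w)\<^sup>2 + (cmod \<kappa>)\<^sup>2 * (\<Sum>k<n. (cmod (c k))\<^sup>2)"
      using contractive_test[OF c, of n "2 * n" w \<kappa>] n by (simp add: \<sigma>_def t_def mult_2)
    with w_le show "(\<Sum>k<n. (cmod (c k))\<^sup>2)
        + (cmod (\<sigma> + \<kappa> * of_real (\<Sum>k<n. (cmod (c k))\<^sup>2)))\<^sup>2
      \<le> 1 + (cmod \<kappa>)\<^sup>2 * (\<Sum>k<n. (cmod (c k))\<^sup>2)"
      by linarith
  qed
  then show ?thesis unfolding \<sigma>n by (simp add: t_def a_def)
qed

section \<open>The Bohr inequality\<close>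

text \<open>Dividing out \<open>z ^ k\<close> leaves a holomorphic \<open>G\<close>. The maximum
  principle on the disc of radius \<open>\<rho>\<close> bounds it by \<open>1 / \<rho> ^ k\<close>,
  and \<open>\<rho> \<rightarrow> 1\<close> gives the bound 1.\<close>

lemma schur_coeffs_shift_bound:
  assumes "schur_coeffs d" "\<And>j. j < k \<Longrightarrow> d j = 0" "cmod \<zeta> < 1" "(\<lambda>j. d j * \<zeta> ^ j) sums s"
  shows "cmod s \<le> cmod \<zeta> ^ k"
proof -
  have shift: "(\<lambda>j. d (j + k) * z ^ (j + k)) sums t \<longleftrightarrow> (\<lambda>j. d j * z ^ j) sums t" for z t
    using assms(2) sums_iff_shift[of "\<lambda>j. d j * z ^ j" k t] by simp
  define G where "G z = (\<Sum>j. d (j + k) * z ^ j)" for z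
  have summ: "summable (\<lambda>j. d (j + k) * z ^ j)" if z1: "cmod z < 1" for z
  proof (cases "z = 0")
    case True
    then show ?thesis by (intro summable_finite[of "{0}"]) auto
  next
    case False
    obtain t where "(\<lambda>j. d j * z ^ j) sums t" using assms(1) z1 unfolding schur_coeffs_def by blast
    then have "(\<lambda>j. (d (j + k) * z ^ j) * z ^ k) sums t"
      using shift[of z t] by (simp add: power_add mult.assoc)
    from sums_divide[OF this, of "z ^ k"] False show ?thesis by (simp add: sums_iff)
  qed
  have G: "(\<lambda>j. d j * z ^ j) sums (G z * z ^ k)" if "cmod z < 1" for z
    using sums_mult2[OF summable_sums[OF summ[OF that]], of "z ^ k"] shift[of z]
    by (simp add: G_def power_add mult.assoc)
  have hol: "G holomorphic_on ball 0 1"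
    by (rule power_series_holomorphic[where a = "\<lambda>j. d (j + k)"])
      (use summ in \<open>auto simp: G_def dest: summable_sums\<close>)
  have Gle: "cmod (G \<zeta>) \<le> 1 / \<rho> ^ k" if \<rho>: "cmod \<zeta> < \<rho>" "\<rho> < 1" for \<rho>
  proof (rule maximum_modulus_frontier[of G "ball 0 \<rho>"])
    have pos: "\<rho> > 0" using \<rho>(1) norm_ge_zero[of \<zeta>] by linarith
    show "G holomorphic_on interior (ball 0 \<rho>)"
      by (rule holomorphic_on_subset[OF hol]) (use \<rho> in auto)
    show "continuous_on (closure (ball 0 \<rho>)) G"
      by (rule continuous_on_subset[OF holomorphic_on_imp_continuous_on[OF hol]])
        (use \<rho> pos in auto)
    fix z assume "z \<in> frontier (ball (0::complex) \<rho>)"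
    then have z: "cmod z = \<rho>" using pos by simp
    obtain t where t: "(\<lambda>j. d j * z ^ j) sums t" "cmod t \<le> 1"
      using assms(1) z \<rho> unfolding schur_coeffs_def by blast
    then have "t = G z * z ^ k" using G[of z] z \<rho> by (auto intro: sums_unique2)
    with t z have "cmod (G z) * \<rho> ^ k \<le> 1" by (simp add: norm_mult norm_power)
    then show "cmod (G z) \<le> 1 / \<rho> ^ k" using pos by (simp add: field_simps)
  qed (use \<rho> in auto)
  have ev: "\<forall>\<^sub>F \<rho> in at_left 1. cmod (G \<zeta>) \<le> 1 / \<rho> ^ k"
    by (rule eventually_at_leftI[of "cmod \<zeta>"]) (use Gle assms(3) in auto)
  have "((\<lambda>\<rho>::real. 1 / \<rho> ^ k) \<longlongrightarrow> 1 / 1 ^ k) (at_left 1)"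
    by (intro tendsto_intros) auto
  from tendsto_lowerbound[OF this ev] have "cmod (G \<zeta>) \<le> 1" by simp
  moreover have "s = G \<zeta> * \<zeta> ^ k" using assms(4) G[OF assms(3)] by (rule sums_unique2)
  ultimately show ?thesis by (simp add: norm_mult norm_power mult_left_le_one_le)
qed

text \<open>The factor \<open>c\<close> is pulled out of one argument of the multilinear map at a
  time, by induction on the number of scaled arguments.\<close>

lemma homogeneous_polynomial_scale:
  assumes "homogeneous_polynomial j P"
  shows "P (c *\<^sub>C x) = c ^ j *\<^sub>C P x"
proof -
  obtain u where u: "continuous_multilinear j u" "\<And>x. P x = u (\<lambda>i. x)"
    using assms by (auto simp: homogeneous_polynomial_def)
  have "u (\<lambda>i. if i < m then c *\<^sub>C x else x) = c ^ m *\<^sub>C u (\<lambda>i. x)" if "m \<le> j" for m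
    using that
  proof (induction m)
    case 0
    then show ?case by (simp add: scaleC_one)
  next
    case (Suc m)
    let ?y = "\<lambda>i. if i < m then c *\<^sub>C x else x"
    have "u (?y(m := c *\<^sub>C x)) = c *\<^sub>C u (?y(m := x))"
      using u(1) Suc.prems unfolding continuous_multilinear_def by simp
    moreover have "?y(m := x) = ?y" by auto
    moreover have "?y(m := c *\<^sub>C x) = (\<lambda>i. if i < Suc m then c *\<^sub>C x else x)"
      by (auto simp: less_Suc_eq)
    ultimately show ?case using Suc by (simp add: scaleC_scaleC)
  qed
  from this[of j] have "u (\<lambda>i. if i < j then c *\<^sub>C x else x) = c ^ j *\<^sub>C P x" by (simp add: u(2))
  moreover have "u (\<lambda>i. if i < j then c *\<^sub>C x else x) = u (\<lambda>i. c *\<^sub>C x)"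
    using u(1) unfolding continuous_multilinear_def by simp
  ultimately show ?thesis by (simp add: u(2))
qed

lemma expansion_along_line:
  assumes "homogeneous_expansion f P" "norm u \<le> 1" "cmod \<zeta> < 1"
  shows "(\<lambda>j. \<zeta> ^ j *\<^sub>C P j u) sums f (\<zeta> *\<^sub>C u)" "\<zeta> *\<^sub>C u \<in> ball 0 1"
proof -
  have "norm (\<zeta> *\<^sub>C u) < 1"
    using mult_left_le[OF assms(2), of "cmod \<zeta>"] assms(3) by (simp add: norm_scaleC)
  then show "\<zeta> *\<^sub>C u \<in> ball 0 1" by simp
  then have "(\<lambda>j. P j (\<zeta> *\<^sub>C u)) sums f (\<zeta> *\<^sub>C u)"
    using assms by (simp add: homogeneous_expansion_def)
  moreover have "P j (\<zeta> *\<^sub>C u) = \<zeta> ^ j *\<^sub>C P j u" for j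
    using assms by (intro homogeneous_polynomial_scale) (simp add: homogeneous_expansion_def)
  ultimately show "(\<lambda>j. \<zeta> ^ j *\<^sub>C P j u) sums f (\<zeta> *\<^sub>C u)" by simp
qed

text \<open>The form \<open>norm u \<le> 1\<close> includes \<open>z = 0\<close>, where
  \<open>sgn z = 0\<close>.\<close>

lemma unit_direction:
  fixes z :: "'a::complex_banach"
  obtains u where "norm u \<le> 1" "z = of_real (norm z) *\<^sub>C u"
proof
  show "norm (sgn z) \<le> 1" by (simp add: norm_sgn)
  show "z = of_real (norm z) *\<^sub>C sgn z"
    unfolding scaleR_scaleC[symmetric] by (cases "z = 0") (simp_all add: sgn_div_norm)
qed

text \<open>A functional norming \<open>\<mu> z\<close>, composed with \<open>\<mu>\<close> on the
  complex line through \<open>z\<close>, gives a scalar Schur function with a zero of order at least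
  \<open>k\<close>.\<close>

lemma schwarz_map_zero_of_order_bound:
  assumes \<mu>: "schwarz_map \<mu>" "zero_of_order k \<mu>" and z: "norm z < 1"
  shows "norm (\<mu> z) \<le> norm z ^ k"
proof -
  obtain Q where Q: "homogeneous_expansion \<mu> Q" "\<And>j x. j < k \<Longrightarrow> Q j x = 0"
    using \<mu>(2) by (auto simp: zero_of_order_def)
  obtain u where u: "norm u \<le> 1" "z = of_real (norm z) *\<^sub>C u" using unit_direction by blast
  obtain \<phi> :: "'a \<Rightarrow> complex" where \<phi>: "bounded_linear \<phi>" "\<And>c x. \<phi> (c *\<^sub>C x) = c * \<phi> x"
    "\<And>x. cmod (\<phi> x) \<le> norm x" "\<phi> (\<mu> z) = of_real (norm (\<mu> z))"
    using norming_functional[of "\<mu> z"] by blast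
  define d where "d j = \<phi> (Q j u)" for j
  have sums: "(\<lambda>j. d j * \<zeta> ^ j) sums \<phi> (\<mu> (\<zeta> *\<^sub>C u))" if "cmod \<zeta> < 1" for \<zeta>
    using bounded_linear.sums[OF \<phi>(1) expansion_along_line(1)[OF Q(1) u(1) that]]
    by (simp add: d_def \<phi>(2) mult.commute)
  have "schur_coeffs d"
    unfolding schur_coeffs_def
  proof (intro allI impI)
    fix \<zeta> :: complex assume \<zeta>: "cmod \<zeta> < 1"
    have "\<mu> (\<zeta> *\<^sub>C u) \<in> ball 0 1"
      using expansion_along_line(2)[OF Q(1) u(1) \<zeta>] \<mu>(1) unfolding schwarz_map_def by blast
    then have "cmod (\<phi> (\<mu> (\<zeta> *\<^sub>C u))) \<le> 1"
      using \<phi>(3)[of "\<mu> (\<zeta> *\<^sub>C u)"] by simp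
    with sums[OF \<zeta>] show "\<exists>s. (\<lambda>n. d n * \<zeta> ^ n) sums s \<and> cmod s \<le> 1" by blast
  qed
  moreover have "d j = 0" if "j < k" for j
    using Q(2)[OF that] \<phi>(1) by (simp add: d_def linear_simps)
  ultimately have "cmod (\<phi> (\<mu> (of_real (norm z) *\<^sub>C u))) \<le> cmod (of_real (norm z)) ^ k"
    using z by (intro schur_coeffs_shift_bound[of d] sums) auto
  then show ?thesis by (simp add: u(2)[symmetric] \<phi>(4))
qed

section \<open>The refined Bohr inequality and its radius\<close>

text \<open>Carlson's bounds have the main term \<open>1 - a\<^sup>2\<close>, whose series sums to
  the right-hand side. The squares subtracted in them sum to exactly the weighted quadratic series
  on the left.\<close>

lemma refined_bohr_sum_bound:
  fixes x :: real
  assumes c: "contractive c" and x: "0 \<le> x" "x < 1"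
  defines "a \<equiv> cmod (c 0)"
  shows "summable (\<lambda>j. cmod (c (Suc j)) * x ^ Suc j)"
    and "summable (\<lambda>j. (cmod (c (Suc j)) * x ^ Suc j)\<^sup>2)"
    and "(\<Sum>j. cmod (c (Suc j)) * x ^ Suc j)
      + (1 / (1 + a) + x / (1 - x)) * (\<Sum>j. (cmod (c (Suc j)) * x ^ Suc j)\<^sup>2)
      \<le> (1 - a\<^sup>2) * (x / (1 - x))"
proof -
  define e where "e n = (cmod (c n))\<^sup>2" for n
  define E where "E n = (\<Sum>k<n. e (Suc k))" for n
  have a0: "a \<ge> 0" by (simp add: a_def)
  have e0: "e n \<ge> 0" for n by (simp add: e_def)
  have E0: "E n \<ge> 0" for n by (simp add: E_def sum_nonneg e0)
  have split: "(\<Sum>k\<le>n. (cmod (c k))\<^sup>2) = a\<^sup>2 + E n" for n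
    by (simp add: E_def e_def a_def sum.atMost_shift)
  have odd: "cmod (c (2 * n + 1)) \<le> 1 - a\<^sup>2 - E n" for n
    using carlson_odd[OF c, of n] unfolding split by simp
  have even: "cmod (c (2 * n + 2)) \<le> 1 - a\<^sup>2 - E n - e (Suc n) / (1 + a)" for n
    using carlson_even[OF c, of "Suc n"] split[of n]
    by (simp add: lessThan_Suc_atMost a_def e_def)
  have E1: "E n \<le> 1 - a\<^sup>2" for n using odd[of n] norm_ge_zero[of "c (2 * n + 1)"] by linarith
  have e1: "e (Suc n) \<le> 1" for n
  proof -
    have "e (Suc n) \<le> E (Suc n)" by (simp add: E_def E0[unfolded E_def])
    with E1[of "Suc n"] show ?thesis using zero_le_power2[of a] by linarith
  qed
  then have c1: "cmod (c (Suc n)) \<le> 1" for n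
    using e1[of n] by (simp add: e_def power_le_one_iff abs_square_le_1)
  have x2: "0 \<le> x\<^sup>2" "x\<^sup>2 < 1" using x by (auto simp: power_less_one_iff abs_square_less_1)
  have geo: "summable (\<lambda>n. x ^ n)" "summable (\<lambda>n. (x\<^sup>2) ^ n)"
    using x x2 by (auto intro!: summable_geometric)
  show s1: "summable (\<lambda>j. cmod (c (Suc j)) * x ^ Suc j)"
    by (rule summable_comparison_test'[OF summable_mult[OF geo(1), of x]])
      (use x c1 in \<open>auto simp: abs_mult mult_left_le_one_le\<close>)
  have sq: "(cmod (c (Suc j)) * x ^ Suc j)\<^sup>2 = e (Suc j) * (x\<^sup>2) ^ Suc j" for j
    by (simp add: e_def power_mult_distrib mult.commute flip: power_mult)
  have se: "summable (\<lambda>j. e (Suc j) * (x\<^sup>2) ^ Suc j)"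
    by (rule summable_comparison_test'[OF summable_mult[OF geo(2), of "x\<^sup>2"]])
      (use x2 e0 e1 in \<open>auto simp: abs_mult mult_left_le_one_le\<close>)
  then show s2: "summable (\<lambda>j. (cmod (c (Suc j)) * x ^ Suc j)\<^sup>2)" by (simp only: sq)
  have sE: "summable (\<lambda>n. E n * (x\<^sup>2) ^ n)"
    by (rule summable_comparison_test'[OF geo(2)])
      (use x2 E0 E1 zero_le_power2[of a] in \<open>auto simp: abs_mult intro!: mult_left_le_one_le order_trans[OF E1]\<close>)
  define V where "V = (\<Sum>j. e (Suc j) * (x\<^sup>2) ^ Suc j)"
  define U where "U = (\<Sum>n. E n * (x\<^sup>2) ^ n)"
  \<comment> \<open>Abel summation: shifting the index, which is free since \<open>E 0 = 0\<close>,
    and splitting \<open>E (Suc n)\<close> expresses \<open>U\<close> through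
    \<open>V\<close>.\<close>
  have "U = (\<Sum>n. E (Suc n) * (x\<^sup>2) ^ Suc n)"
    using suminf_split_head[OF sE] by (simp add: U_def E_def)
  also have "\<dots> = (\<Sum>n. x\<^sup>2 * (E n * (x\<^sup>2) ^ n) + e (Suc n) * (x\<^sup>2) ^ Suc n)"
    by (simp add: E_def algebra_simps)
  also have "\<dots> = x\<^sup>2 * U + V"
    using suminf_add[OF summable_mult[OF sE, of "x\<^sup>2"] se] suminf_mult[OF sE, of "x\<^sup>2"]
    by (simp add: U_def V_def)
  finally have UV: "(1 - x\<^sup>2) * U = V" by (simp add: algebra_simps)
  \<comment> \<open>Degrees \<open>2 * n + 1\<close> and \<open>2 * n + 2\<close> are paired because
    their Carlson bounds share the partial sum \<open>E n\<close>.\<close>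
  have sums1: "(\<lambda>n. cmod (c (2 * n + 1)) * x ^ (2 * n + 1) + cmod (c (2 * n + 2)) * x ^ (2 * n + 2))
      sums (\<Sum>j. cmod (c (Suc j)) * x ^ Suc j)"
    using sums_group[OF summable_sums[OF s1], of 2]
    by (simp add: mult.commute[of _ 2] numeral_2_eq_2)
  have sums2: "(\<lambda>n. (1 - a\<^sup>2) * (x + x\<^sup>2) * (x\<^sup>2) ^ n - (x + x\<^sup>2) * (E n * (x\<^sup>2) ^ n)
        - (e (Suc n) * (x\<^sup>2) ^ Suc n) / (1 + a))
      sums ((1 - a\<^sup>2) * (x + x\<^sup>2) * (1 / (1 - x\<^sup>2)) - (x + x\<^sup>2) * U - V / (1 + a))"
    unfolding U_def V_def using x2
    by (intro sums_diff sums_mult sums_divide summable_sums sE se geometric_sums) auto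
  have pair: "cmod (c (2 * n + 1)) * x ^ (2 * n + 1) + cmod (c (2 * n + 2)) * x ^ (2 * n + 2)
      \<le> (1 - a\<^sup>2) * (x + x\<^sup>2) * (x\<^sup>2) ^ n - (x + x\<^sup>2) * (E n * (x\<^sup>2) ^ n)
        - (e (Suc n) * (x\<^sup>2) ^ Suc n) / (1 + a)" for n
  proof -
    have "cmod (c (2 * n + 1)) * x ^ (2 * n + 1) + cmod (c (2 * n + 2)) * x ^ (2 * n + 2)
        \<le> (1 - a\<^sup>2 - E n) * x ^ (2 * n + 1) + (1 - a\<^sup>2 - E n - e (Suc n) / (1 + a)) * x ^ (2 * n + 2)"
      using x by (intro add_mono mult_right_mono odd even) auto
    also have "\<dots> = (1 - a\<^sup>2) * (x + x\<^sup>2) * (x\<^sup>2) ^ n - (x + x\<^sup>2) * (E n * (x\<^sup>2) ^ n)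
        - (e (Suc n) * (x\<^sup>2) ^ Suc n) / (1 + a)"
    proof -
      have pows: "x ^ (2 * n + 1) = x * (x\<^sup>2) ^ n" "x ^ (2 * n + 2) = x\<^sup>2 * (x\<^sup>2) ^ n"
        by (simp_all add: power_mult power2_eq_square)
      show ?thesis unfolding pows by (simp add: algebra_simps)
    qed
    finally show ?thesis .
  qed
  have "(\<Sum>j. cmod (c (Suc j)) * x ^ Suc j)
      \<le> (1 - a\<^sup>2) * (x + x\<^sup>2) * (1 / (1 - x\<^sup>2)) - (x + x\<^sup>2) * U - V / (1 + a)"
    by (rule sums_le[OF pair sums1 sums2])
  \<comment> \<open>Since \<open>(x + x\<^sup>2) / (1 - x\<^sup>2) = x / (1 - x)\<close>, this is
    where the second part of the weight arises.\<close>
  moreover have "(x + x\<^sup>2) * U = x / (1 - x) * V"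
    using x by (simp add: UV[symmetric] field_simps power2_eq_square)
  moreover have "(1 - a\<^sup>2) * (x + x\<^sup>2) * (1 / (1 - x\<^sup>2)) = (1 - a\<^sup>2) * (x / (1 - x))"
  proof -
    have "1 - x\<^sup>2 = (1 - x) * (1 + x)" "x + x\<^sup>2 = x * (1 + x)"
      by (simp_all add: power2_eq_square algebra_simps)
    then show ?thesis using x by simp
  qed
  moreover have "(1 / (1 + a) + x / (1 - x)) * V = V / (1 + a) + x / (1 - x) * V"
    by (simp add: distrib_right)
  ultimately show "(\<Sum>j. cmod (c (Suc j)) * x ^ Suc j)
      + (1 / (1 + a) + x / (1 - x)) * (\<Sum>j. (cmod (c (Suc j)) * x ^ Suc j)\<^sup>2)
      \<le> (1 - a\<^sup>2) * (x / (1 - x))"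
    unfolding sq V_def[symmetric] by linarith
qed

text \<open>Bernoulli's inequality for the base \<open>a\<^sup>2\<close> and the exponent
  \<open>min p 2 / 2\<close>. Capping \<open>p\<close> at 2 keeps this exponent at most 1.\<close>

lemma powr_Bernoulli:
  fixes a p :: real
  assumes "0 \<le> a" "a \<le> 1" "p > 0"
  shows "a powr p + (1 - a\<^sup>2) * (min p 2 / 2) \<le> 1"
proof (cases "a = 0")
  case True
  then show ?thesis by simp
next
  case False
  with assms have a: "0 < a" by simp
  define m where "m = min p 2"
  have m: "0 < m" "m \<le> 2" using assms by (auto simp: m_def)
  have "a powr p \<le> a powr m"
    using a assms by (intro powr_mono') (auto simp: m_def)
  also have "a powr m = (a\<^sup>2) powr (m / 2)"
  proof -
    have "a\<^sup>2 = a powr 2" using a by simp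
    then show ?thesis by (simp only: powr_powr) simp
  qed
  also have "\<dots> \<le> 1 + (m / 2) * (a\<^sup>2 - 1)"
  proof -
    \<comment> \<open>Convexity of \<open>exp\<close> between 0 and \<open>ln (a\<^sup>2)\<close>,
      with weight \<open>m / 2\<close>.\<close>
    have "exp ((1 - m / 2) *\<^sub>R 0 + (m / 2) *\<^sub>R ln (a\<^sup>2)) \<le> (1 - m / 2) * exp 0 + (m / 2) * exp (ln (a\<^sup>2))"
      by (rule convex_onD[OF exp_convex]) (use m in auto)
    then show ?thesis using a by (simp add: powr_def algebra_simps)
  qed
  finally show ?thesis by (simp add: m_def[symmetric] algebra_simps)
qed

text \<open>In terms of \<open>x = r ^ (q * k)\<close> the radius condition reads
  \<open>x / (1 - x) \<le> min p 2 / 2\<close>, the slope in \<open>powr_Bernoulli\<close>.\<close>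

lemma bohr_radius_power:
  assumes "k \<ge> 1" "q \<ge> 1" "p > 0"
  shows "bohr_radius k p q ^ (q * k) = min p 2 / (2 + min p 2)"
    and "0 < bohr_radius k p q" "bohr_radius k p q < 1"
proof -
  have pos: "q * k > 0" using assms by simp
  have m: "0 < min p 2" using assms by simp
  then have y: "0 < min p 2 / (2 + min p 2)" "min p 2 / (2 + min p 2) < 1" by (auto simp: field_simps)
  show "bohr_radius k p q ^ (q * k) = min p 2 / (2 + min p 2)"
    unfolding bohr_radius_def using pos y by (intro real_root_pow_pos2) auto
  show "0 < bohr_radius k p q" "bohr_radius k p q < 1"
    unfolding bohr_radius_def using pos y by auto
qed

text \<open>Along the direction \<open>u\<close> of \<open>\<mu> z\<close> the terms become
  \<open>cmod (c j) * s ^ j\<close> with \<open>s = norm (\<mu> z) ^ q\<close>, and the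
  order-\<open>k\<close> Schwarz lemma gives \<open>s \<le> x\<close>. The scalar bound and
  Bernoulli's inequality then finish.\<close>

lemma bohr_inequality:
  fixes f :: "'a::complex_banach \<Rightarrow> complex"
  assumes "k \<ge> 1" "q \<ge> 1" "p > 0"
    and f: "f ` ball 0 1 \<subseteq> ball 0 1" and P: "homogeneous_expansion f P"
    and \<mu>: "schwarz_map \<mu>" "zero_of_order k \<mu>" and z: "norm z \<le> bohr_radius k p q"
  shows "summable (\<lambda>j. cmod (P (q * Suc j) (\<mu> z)))"
    and "summable (\<lambda>j. (cmod (P (q * Suc j) (\<mu> z)))\<^sup>2)"
    and "bohr_sum k p q f P \<mu> z \<le> 1"
proof -
  note R = bohr_radius_power[OF assms(1-3)]
  define w where "w = \<mu> z"
  define x where "x = norm z ^ (q * k)"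
  define s where "s = norm w ^ q"
  define a where "a = cmod (f 0)"
  have z1: "norm z < 1" using z R by linarith
  have "norm w \<le> norm z ^ k"
    unfolding w_def by (rule schwarz_map_zero_of_order_bound[OF \<mu> z1])
  then have "s \<le> (norm z ^ k) ^ q" unfolding s_def by (intro power_mono) auto
  then have sx: "0 \<le> s" "s \<le> x" by (simp_all add: s_def x_def power_mult mult.commute[of q])
  have xR: "x \<le> min p 2 / (2 + min p 2)"
    unfolding x_def R(1)[symmetric] using z by (intro power_mono) auto
  have m: "0 < min p 2" using assms by simp
  have x: "0 \<le> x" "x < 1" and xm: "x / (1 - x) \<le> min p 2 / 2"
  proof -
    show "0 \<le> x" by (simp add: x_def)
    have "min p 2 / (2 + min p 2) < 1" using m by (simp add: field_simps)
    with xR show x1: "x < 1" by linarith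
    from xR m have "x * (2 + min p 2) \<le> min p 2" by (simp add: pos_le_divide_eq)
    with x1 show "x / (1 - x) \<le> min p 2 / 2"
      by (simp add: pos_divide_le_eq algebra_simps del: min_less_iff_conj min.bounded_iff)
  qed
  obtain u where u: "norm u \<le> 1" "w = of_real (norm w) *\<^sub>C u" using unit_direction by blast
  define b where "b j = P j u" for j
  have bsums: "(\<lambda>j. b j * \<zeta> ^ j) sums f (\<zeta> *\<^sub>C u)" if "cmod \<zeta> < 1" for \<zeta>
    using expansion_along_line(1)[OF P u(1) that] by (simp add: b_def scaleC_complex_def mult.commute)
  have schur: "schur_coeffs b"
    unfolding schur_coeffs_def
  proof (intro allI impI)
    fix \<zeta> :: complex assume \<zeta>: "cmod \<zeta> < 1"
    have "f (\<zeta> *\<^sub>C u) \<in> ball 0 1"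
      using expansion_along_line(2)[OF P u(1) \<zeta>] f by blast
    with bsums[OF \<zeta>] show "\<exists>t. (\<lambda>n. b n * \<zeta> ^ n) sums t \<and> cmod t \<le> 1"
      by (intro exI[of _ "f (\<zeta> *\<^sub>C u)"]) simp
  qed
  define c where "c j = b (q * j)" for j
  have c: "contractive c"
    unfolding c_def by (rule contractive_section[OF schur_coeffs_contractive[OF schur] assms(2)])
  have "c 0 = f 0"
    using bsums[of 0] by (simp add: c_def powser_sums_zero_iff)
  then have a: "cmod (c 0) = a" "0 \<le> a" "a \<le> 1"
    using f by (auto simp: a_def image_subset_iff dest!: bspec[of _ _ 0])
  have Pw: "cmod (P (q * j) w) = cmod (c j) * s ^ j" for j
  proof -
    have "P (q * j) w = of_real (norm w) ^ (q * j) *\<^sub>C P (q * j) u"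
      using P by (subst u(2), intro homogeneous_polynomial_scale) (simp add: homogeneous_expansion_def)
    then show ?thesis
      by (simp add: scaleC_complex_def c_def b_def s_def norm_mult norm_power power_mult)
  qed
  note bound = refined_bohr_sum_bound[OF c x, unfolded a(1)]
  have le: "cmod (P (q * Suc j) w) \<le> cmod (c (Suc j)) * x ^ Suc j" for j
    unfolding Pw using sx by (intro mult_left_mono power_mono) auto
  then have le2: "(cmod (P (q * Suc j) w))\<^sup>2 \<le> (cmod (c (Suc j)) * x ^ Suc j)\<^sup>2" for j
    by (intro power_mono) auto
  have s1: "summable (\<lambda>j. cmod (P (q * Suc j) w))"
    by (rule summable_comparison_test'[OF bound(1)]) (use le in auto)
  have s2: "summable (\<lambda>j. (cmod (P (q * Suc j) w))\<^sup>2)"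
    by (rule summable_comparison_test'[OF bound(2)]) (use le2 in auto)
  show "summable (\<lambda>j. cmod (P (q * Suc j) (\<mu> z)))" "summable (\<lambda>j. (cmod (P (q * Suc j) (\<mu> z)))\<^sup>2)"
    using s1 s2 by (simp_all add: w_def)
  have "bohr_sum k p q f P \<mu> z = a powr p + ((\<Sum>j. cmod (P (q * Suc j) w))
      + (1 / (1 + a) + x / (1 - x)) * (\<Sum>j. (cmod (P (q * Suc j) w))\<^sup>2))"
    by (simp add: bohr_sum_def Let_def w_def x_def a_def)
  \<comment> \<open>Only the two series grow when \<open>s\<close> is replaced by \<open>x\<close>;
    the weight already contains \<open>x\<close>.\<close>
  also have "\<dots> \<le> a powr p + ((\<Sum>j. cmod (c (Suc j)) * x ^ Suc j)
      + (1 / (1 + a) + x / (1 - x)) * (\<Sum>j. (cmod (c (Suc j)) * x ^ Suc j)\<^sup>2))"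
    using x a by (intro add_left_mono add_mono mult_left_mono suminf_le le le2 s1 s2 bound) auto
  also have "\<dots> \<le> a powr p + (1 - a\<^sup>2) * (x / (1 - x))"
    by (intro add_left_mono bound(3))
  also have "\<dots> \<le> a powr p + (1 - a\<^sup>2) * (min p 2 / 2)"
    using a xm by (intro add_left_mono mult_left_mono) (auto simp: power_le_one)
  also have "\<dots> \<le> 1" by (rule powr_Bernoulli) (use a assms in auto)
  finally show "bohr_sum k p q f P \<mu> z \<le> 1" .
qed

section \<open>Extremal mappings\<close>

locale unit_functional =
  fixes \<phi> :: "'a::complex_banach \<Rightarrow> complex"
  assumes bounded_linear_\<phi>: "bounded_linear \<phi>"
    and scaleC_\<phi>: "\<phi> (c *\<^sub>C x) = c * \<phi> x"
    and norm_\<phi>_le: "cmod (\<phi> x) \<le> norm x"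
begin

lemma \<phi>_add: "\<phi> (x + y) = \<phi> x + \<phi> y"
  and \<phi>_zero: "\<phi> 0 = 0"
  using bounded_linear_\<phi> by (simp_all add: linear_simps)

text \<open>The underlying multilinear map is a product of values of \<open>\<phi>\<close>. The
  fixed vector \<open>d\<close> lets one lemma serve both the vector-valued \<open>\<mu>\<close> and
  the scalar-valued \<open>f\<close>.\<close>

lemma homogeneous_polynomial_power:
  fixes d :: "'b::complex_banach"
  shows "homogeneous_polynomial j (\<lambda>x. \<phi> x ^ j *\<^sub>C d)"
  unfolding homogeneous_polynomial_def
proof (intro exI conjI allI)
  define u where "u y = (\<Prod>i<j. \<phi> (y i)) *\<^sub>C d" for y
  have upd: "u (y(i := v)) = \<phi> v *\<^sub>C (\<Prod>l\<in>{..<j} - {i}. \<phi> (y l)) *\<^sub>C d" if "i < j" for y i v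
    unfolding u_def scaleC_scaleC
    by (subst prod.remove[of _ i]) (use that in \<open>auto intro!: arg_cong[of _ _ "\<lambda>c. c *\<^sub>C d"]\<close>)
  have "continuous_on UNIV u"
    unfolding u_def
    by (intro bounded_linear.continuous_on[OF bounded_linear_scaleC_left] continuous_on_prod
        bounded_linear.continuous_on[OF bounded_linear_\<phi>] continuous_on_product_coordinates)
  moreover have "u x = u y" if "\<forall>i<j. x i = y i" for x y
    using that by (simp add: u_def)
  ultimately show "continuous_multilinear j u"
    unfolding continuous_multilinear_def
    by (auto simp: upd scaleC_\<phi> scaleC_scaleC \<phi>_add distrib_right scaleC_add_left mult.assoc)
  show "\<phi> x ^ j *\<^sub>C d = u (\<lambda>i. x)" for x by (simp add: u_def)
qed

lemma holomorphic_map_on_compose: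
  fixes d :: "'b::complex_banach"
  assumes "h holomorphic_on ball 0 1"
  shows "holomorphic_map_on (\<lambda>x. h (\<phi> x) *\<^sub>C d) (ball 0 1)"
  unfolding holomorphic_map_on_def
proof
  fix x :: 'a assume "x \<in> ball 0 1"
  then have "\<phi> x \<in> ball 0 1" using norm_\<phi>_le[of x] by simp
  then obtain D where "(h has_field_derivative D) (at (\<phi> x))"
    using assms unfolding holomorphic_on_open[OF open_ball] by blast
  then have h: "(h has_derivative (*) D) (at (\<phi> x))" by (simp add: has_field_derivative_def)
  have "(\<phi> has_derivative \<phi>) (at x)"
    by (rule bounded_linear_imp_has_derivative[OF bounded_linear_\<phi>])
  from bounded_linear.has_derivative[OF bounded_linear_scaleC_left has_derivative_compose[OF this h]]
  have "((\<lambda>x. h (\<phi> x) *\<^sub>C d) has_derivative (\<lambda>v. (D * \<phi> v) *\<^sub>C d)) (at x)" .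
  moreover have "(D * \<phi> (c *\<^sub>C v)) *\<^sub>C d = c *\<^sub>C (D * \<phi> v) *\<^sub>C d" for c v
    by (simp add: scaleC_\<phi> scaleC_scaleC mult_ac)
  ultimately show "\<exists>f'. ((\<lambda>x. h (\<phi> x) *\<^sub>C d) has_derivative f') (at x) \<and>
      (\<forall>c v. f' (c *\<^sub>C v) = c *\<^sub>C f' v)"
    by blast
qed

lemma power_schwarz_map:
  assumes "norm u = 1" "\<phi> u = 1" "k \<ge> 1"
  shows "schwarz_map (\<lambda>x. \<phi> x ^ k *\<^sub>C u)" "zero_of_order k (\<lambda>x. \<phi> x ^ k *\<^sub>C u)"
proof -
  have "norm (\<phi> x ^ k *\<^sub>C u) < 1" if "norm x < 1" for x
    using norm_\<phi>_le[of x] that assms by (simp add: norm_scaleC norm_power power_less_one_iff)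
  moreover have "\<phi> 0 ^ k *\<^sub>C u = 0"
    using assms by (simp add: \<phi>_zero power_0_left)
  moreover have "holomorphic_map_on (\<lambda>x. \<phi> x ^ k *\<^sub>C u) (ball 0 1)"
    by (rule holomorphic_map_on_compose[of "\<lambda>z. z ^ k"]) (intro holomorphic_intros)
  ultimately show "schwarz_map (\<lambda>x. \<phi> x ^ k *\<^sub>C u)"
    by (auto simp: schwarz_map_def)
  \<comment> \<open>Keeping the power \<open>j\<close> and putting the case distinction into the
    vector makes each \<open>Q j\<close> an instance of
    \<open>homogeneous_polynomial_power\<close>.\<close>
  define Q where "Q j x = \<phi> x ^ j *\<^sub>C (if j = k then u else 0)" for j x
  have "(\<lambda>j. Q j x) sums (\<phi> x ^ k *\<^sub>C u)" for x
  proof -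
    have "(\<lambda>j. Q j x) = (\<lambda>j. if j = k then \<phi> x ^ k *\<^sub>C u else 0)"
      by (auto simp: Q_def)
    then show ?thesis using sums_single[of k "\<lambda>j. \<phi> x ^ k *\<^sub>C u"] by simp
  qed
  moreover have "homogeneous_polynomial j (Q j)" for j
    unfolding Q_def by (rule homogeneous_polynomial_power)
  ultimately have "homogeneous_expansion (\<lambda>x. \<phi> x ^ k *\<^sub>C u) Q"
    by (simp add: homogeneous_expansion_def)
  moreover have "Q k u \<noteq> 0" using assms by (auto simp: Q_def scaleC_one)
  ultimately show "zero_of_order k (\<lambda>x. \<phi> x ^ k *\<^sub>C u)"
    unfolding zero_of_order_def by (intro exI[of _ Q]) (auto simp: Q_def)
qed

section \<open>The extremal function and its Bohr sum\<close>

definition extremal :: "real \<Rightarrow> nat \<Rightarrow> 'a \<Rightarrow> complex"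
  where "extremal a q x = (of_real a - \<phi> x ^ q) / (1 - of_real a * \<phi> x ^ q)"

text \<open>Taylor coefficients of \<open>(a - t ^ q) / (1 - a * t ^ q)\<close>. For
  \<open>a = 0\<close> the convention \<open>0 ^ 0 = 1\<close> leaves the single coefficient -1 in
  degree \<open>q\<close>.\<close>

definition extremal_coeff :: "real \<Rightarrow> nat \<Rightarrow> nat \<Rightarrow> real"
  where "extremal_coeff a q n =
    (if n = 0 then a else if q dvd n then - (1 - a\<^sup>2) * a ^ (n div q - 1) else 0)"

definition extremal_poly :: "real \<Rightarrow> nat \<Rightarrow> nat \<Rightarrow> 'a \<Rightarrow> complex"
  where "extremal_poly a q n x = of_real (extremal_coeff a q n) * \<phi> x ^ n"

lemma one_minus_nonzero:
  assumes "0 \<le> a" "a < 1" "cmod t < 1"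
  shows "cmod (of_real a * t) < 1" "1 - of_real a * t \<noteq> 0"
proof -
  have "a * cmod t \<le> cmod t" using assms by (intro mult_left_le_one_le) auto
  with assms show less: "cmod (of_real a * t) < 1" by (simp add: norm_mult)
  then show "1 - of_real a * t \<noteq> 0" by auto
qed

lemma extremal:
  assumes a: "0 \<le> a" "a < 1" and q: "q \<ge> 1"
  shows "holomorphic_map_on (extremal a q) (ball 0 1)"
    and "extremal a q ` ball 0 1 \<subseteq> ball 0 1"
    and "homogeneous_expansion (extremal a q) (extremal_poly a q)"
proof -
  have tq: "cmod (t ^ q) < 1" if "cmod t < 1" for t :: complex
    using that q by (simp add: norm_power power_less_one_iff)
  have "(\<lambda>t. (of_real a - t ^ q) / (1 - of_real a * t ^ q)) holomorphic_on ball 0 1"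
    by (intro holomorphic_intros) (use one_minus_nonzero[OF a tq] in auto)
  from holomorphic_map_on_compose[OF this, of "1::complex"]
  show "holomorphic_map_on (extremal a q) (ball 0 1)"
    by (simp add: scaleC_complex_def extremal_def[abs_def])
  have "cmod (extremal a q x) < 1" if "norm x < 1" for x
  proof -
    have "cmod (\<phi> x ^ q) < 1" using norm_\<phi>_le[of x] that by (intro tq) simp
    \<comment> \<open>Up to sign, \<open>extremal a q x\<close> is the disc automorphism vanishing
      at \<open>a\<close>, evaluated at \<open>\<phi> x ^ q\<close>.\<close>
    then have "cmod (Moebius_function 0 (of_real a) (\<phi> x ^ q)) < 1"
      by (intro Moebius_function_norm_lt_1) (use a in auto)
    then show ?thesis
      by (simp add: Moebius_function_def extremal_def norm_divide norm_minus_commute)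
  qed
  then show "extremal a q ` ball 0 1 \<subseteq> ball 0 1" by auto
  have "(\<lambda>n. extremal_poly a q n x) sums extremal a q x" if "norm x < 1" for x
  proof -
    define T where "T = \<phi> x ^ q"
    have "cmod T < 1" unfolding T_def using norm_\<phi>_le[of x] that by (intro tq) simp
    note T = one_minus_nonzero[OF a this]
    have "(\<lambda>j. (- (1 - (of_real a)\<^sup>2) * T) * (of_real a * T) ^ j)
        sums ((- (1 - (of_real a)\<^sup>2) * T) * (1 / (1 - of_real a * T)))"
      by (intro sums_mult geometric_sums T)
    also have "(\<lambda>j. (- (1 - (of_real a)\<^sup>2) * T) * (of_real a * T) ^ j)
        = (\<lambda>j. extremal_poly a q (q * Suc j) x)"
      using q by (auto simp: extremal_poly_def extremal_coeff_def T_def power_mult[symmetric]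
          power_mult_distrib power_add fun_eq_iff)
    finally have "(\<lambda>j. extremal_poly a q (q * j) x)
        sums ((- (1 - (of_real a)\<^sup>2) * T) * (1 / (1 - of_real a * T)) + extremal_poly a q (q * 0) x)"
      by (rule sums_Suc)
    also have "(- (1 - (of_real a)\<^sup>2) * T) * (1 / (1 - of_real a * T)) + extremal_poly a q (q * 0) x
        = extremal a q x"
      using T(2) by (simp add: extremal_def extremal_poly_def extremal_coeff_def T_def[symmetric]
          field_simps power2_eq_square)
    finally have "(\<lambda>j. extremal_poly a q (q * j) x) sums extremal a q x" .
    moreover have "strict_mono ((*) q)" using q by (auto simp: strict_mono_def)
    \<comment> \<open>Degrees not divisible by \<open>q\<close> contribute nothing, so the series
      over multiples of \<open>q\<close> is the whole expansion.\<close>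
    moreover have "extremal_poly a q n x = 0" if "n \<notin> range ((*) q)" for n
    proof -
      have "\<not> q dvd n" using that by (auto elim!: dvdE)
      then show ?thesis by (auto simp: extremal_poly_def extremal_coeff_def)
    qed
    ultimately show ?thesis
      using sums_mono_reindex[of "(*) q" "\<lambda>n. extremal_poly a q n x" "extremal a q x"] by blast
  qed
  moreover have "homogeneous_polynomial n (extremal_poly a q n)" for n
    using homogeneous_polynomial_power[of n "complex_of_real (extremal_coeff a q n)"]
    by (simp add: extremal_poly_def[abs_def] scaleC_complex_def mult.commute)
  ultimately show "homogeneous_expansion (extremal a q) (extremal_poly a q)"
    by (simp add: homogeneous_expansion_def)
qed

text \<open>At \<open>z = R u\<close> the functional takes the value
  \<open>\<phi> (\<mu> z) = R ^ k\<close>, so both series are geometric, with ratios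
  \<open>a * x\<close> and \<open>(a * x)\<^sup>2\<close>.\<close>

lemma extremal_bohr_sum:
  fixes R :: real
  assumes a: "0 \<le> a" "a < 1" and kq: "q \<ge> 1" "k \<ge> 1" and u: "norm u = 1" "\<phi> u = 1"
    and R: "0 < R" "R < 1"
  defines "x \<equiv> R ^ (q * k)" and "z \<equiv> of_real R *\<^sub>C u" and "\<mu> \<equiv> \<lambda>x. \<phi> x ^ k *\<^sub>C u"
  shows "summable (\<lambda>j. cmod (extremal_poly a q (q * Suc j) (\<mu> z)))"
    and "summable (\<lambda>j. (cmod (extremal_poly a q (q * Suc j) (\<mu> z)))\<^sup>2)"
    and "bohr_sum k p q (extremal a q) (extremal_poly a q) \<mu> z
      = a powr p + (1 - a\<^sup>2) * (x / (1 - a * x))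
        + (1 / (1 + a) + x / (1 - x)) * (((1 - a\<^sup>2) * x)\<^sup>2 / (1 - (a * x)\<^sup>2))"
proof -
  have x: "0 < x" "x < 1" using R kq by (auto simp: x_def power_less_one_iff)
  have ax: "0 \<le> a * x" "a * x < 1"
    using a x mult_left_le_one_le[of x a] by (auto intro: le_less_trans[of _ x])
  then have ax2: "0 \<le> (a * x)\<^sup>2" "(a * x)\<^sup>2 < 1" by (auto simp: power_less_one_iff)
  have a2: "a\<^sup>2 \<le> 1" using a by (simp add: power_le_one)
  have \<phi>\<mu>: "\<phi> (\<mu> z) = of_real (R ^ k)" by (simp add: \<mu>_def z_def scaleC_\<phi> u)
  have norm_term: "cmod (extremal_poly a q (q * Suc j) (\<mu> z)) = (1 - a\<^sup>2) * x * (a * x) ^ j" for j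
  proof -
    have "extremal_coeff a q (q * Suc j) = - ((1 - a\<^sup>2) * a ^ j)"
      using kq by (simp add: extremal_coeff_def algebra_simps del: mult_Suc_right)
    then have "cmod (extremal_poly a q (q * Suc j) (\<mu> z))
        = \<bar>(1 - a\<^sup>2) * a ^ j\<bar> * \<bar>R ^ k\<bar> ^ (q * Suc j)"
      unfolding extremal_poly_def \<phi>\<mu> norm_mult norm_power norm_of_real by simp
    also have "\<dots> = (1 - a\<^sup>2) * a ^ j * (R ^ k) ^ (q * Suc j)"
      using a a2 R by (simp add: abs_mult)
    also have "(R ^ k) ^ (q * Suc j) = x * x ^ j"
      by (simp add: x_def algebra_simps flip: power_mult power_add)
    finally show ?thesis by (simp add: power_mult_distrib mult_ac)
  qed
  have sq: "(cmod (extremal_poly a q (q * Suc j) (\<mu> z)))\<^sup>2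
      = ((1 - a\<^sup>2) * x)\<^sup>2 * ((a * x)\<^sup>2) ^ j" for j
    unfolding norm_term power_mult_distrib[of _ "(a * x) ^ j"] by (simp add: mult.commute flip: power_mult)
  have s1: "(\<lambda>j. cmod (extremal_poly a q (q * Suc j) (\<mu> z)))
      sums ((1 - a\<^sup>2) * x * (1 / (1 - a * x)))"
    unfolding norm_term using ax by (intro sums_mult geometric_sums) auto
  have s2: "(\<lambda>j. (cmod (extremal_poly a q (q * Suc j) (\<mu> z)))\<^sup>2)
      sums (((1 - a\<^sup>2) * x)\<^sup>2 * (1 / (1 - (a * x)\<^sup>2)))"
    unfolding sq using ax2 by (intro sums_mult geometric_sums) auto
  show "summable (\<lambda>j. cmod (extremal_poly a q (q * Suc j) (\<mu> z)))"
    "summable (\<lambda>j. (cmod (extremal_poly a q (q * Suc j) (\<mu> z)))\<^sup>2)"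
    using s1 s2 by (auto simp: sums_iff)
  have "extremal a q 0 = of_real a"
    using kq by (simp add: extremal_def \<phi>_zero power_0_left)
  moreover have "norm z = R" using R u by (simp add: z_def norm_scaleC)
  ultimately show "bohr_sum k p q (extremal a q) (extremal_poly a q) \<mu> z
      = a powr p + (1 - a\<^sup>2) * (x / (1 - a * x))
        + (1 / (1 + a) + x / (1 - x)) * (((1 - a\<^sup>2) * x)\<^sup>2 / (1 - (a * x)\<^sup>2))"
    using a sums_unique[OF s1] sums_unique[OF s2] by (simp add: bohr_sum_def Let_def x_def)
qed

end

text \<open>For \<open>p \<ge> 2\<close> the choice \<open>a = 0\<close> collapses the expression to
  \<open>x / (1 - x)\<close>. For \<open>p < 2\<close> the quadratic term is dropped; the rest
  \<open>g\<close> has \<open>g 1 = 1\<close> and the negative derivative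
  \<open>p - 2 * x / (1 - x)\<close> at 1, so it exceeds 1 just to the left.\<close>

lemma extremal_parameter:
  fixes x p :: real
  assumes p: "p > 0" and x: "min p 2 / (2 + min p 2) < x" "x < 1"
  obtains a where "0 \<le> a" "a < 1"
    "1 < a powr p + (1 - a\<^sup>2) * (x / (1 - a * x))
        + (1 / (1 + a) + x / (1 - x)) * (((1 - a\<^sup>2) * x)\<^sup>2 / (1 - (a * x)\<^sup>2))"
proof -
  have "0 < min p 2 / (2 + min p 2)" using p by simp
  with x have x0: "0 < x" by linarith
  show ?thesis
  proof (cases "p \<ge> 2")
    case True
    then have "x > 1 / 2" using x by simp
    then have "1 < x / (1 - x)" using x by (simp add: field_simps)
    also have "x / (1 - x) = x + (1 + x / (1 - x)) * x\<^sup>2"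
      using x by (simp add: field_simps power2_eq_square)
    finally show ?thesis by (intro that[of 0]) auto
  next
    case False
    then have "p < (2 + p) * x" using x p by (simp add: field_simps)
    then have neg: "p - 2 * x / (1 - x) < 0" using x by (simp add: field_simps)
    define g where "g a = a powr p + (1 - a\<^sup>2) * (x / (1 - a * x))" for a
    have "(g has_real_derivative (p - 2 * x / (1 - x))) (at 1)"
      unfolding g_def using x by (auto intro!: derivative_eq_intros)
    from DERIV_neg_dec_left[OF this neg] obtain d where d: "d > 0" "\<And>h. 0 < h \<Longrightarrow> h < d \<Longrightarrow> g 1 < g (1 - h)"
      by blast
    \<comment> \<open>The step \<open>min d 1 / 2\<close> is positive and below \<open>d\<close>,
      and it keeps \<open>a\<close> at least 1/2.\<close>
    define a where "a = 1 - min d 1 / 2"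
    have a: "0 \<le> a" "a < 1" using d by (auto simp: a_def)
    have "a * x < 1" "0 \<le> a * x" using a x x0 mult_left_le_one_le[of x a]
      by (auto intro: le_less_trans[of _ x])
    then have "(a * x)\<^sup>2 < 1" by (auto simp: power_less_one_iff)
    then have "0 \<le> (1 / (1 + a) + x / (1 - x)) * (((1 - a\<^sup>2) * x)\<^sup>2 / (1 - (a * x)\<^sup>2))"
      using a x x0 by auto
    moreover have "1 < g a" using d(2)[of "min d 1 / 2"] d(1) by (simp add: g_def a_def)
    ultimately show ?thesis using that[OF a] by (simp add: g_def)
  qed
qed

text \<open>Convergence of both series is asserted in each half, because only then does
  \<open>bohr_sum\<close> carry the intended value. For sharpness, \<open>nontrivial\<close>
  supplies the unit vector at which \<open>\<phi>\<close> is norming.\<close>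

theorem theorem11:
  fixes k q :: nat and p :: real
  assumes nontrivial: "\<exists>x::'a::complex_banach. x \<noteq> 0"
    and "k \<ge> 1" and "q \<ge> 1" and "p > 0"
  shows "(\<forall>(f :: 'a \<Rightarrow> complex) P \<mu> z.
      holomorphic_map_on f (ball 0 1) \<longrightarrow> f ` ball 0 1 \<subseteq> ball 0 1 \<longrightarrow>
      homogeneous_expansion f P \<longrightarrow>
      schwarz_map \<mu> \<longrightarrow> zero_of_order k \<mu> \<longrightarrow>
      norm z \<le> bohr_radius k p q \<longrightarrow>
        summable (\<lambda>j. cmod (P (q * Suc j) (\<mu> z))) \<and>
        summable (\<lambda>j. (cmod (P (q * Suc j) (\<mu> z)))\<^sup>2) \<and>
        bohr_sum k p q f P \<mu> z \<le> 1)
    \<and> (\<forall>R. bohr_radius k p q < R \<and> R < 1 \<longrightarrow>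
      (\<exists>(f :: 'a \<Rightarrow> complex) P \<mu> z.
        holomorphic_map_on f (ball 0 1) \<and> f ` ball 0 1 \<subseteq> ball 0 1 \<and>
        homogeneous_expansion f P \<and>
        schwarz_map \<mu> \<and> zero_of_order k \<mu> \<and>
        norm z \<le> R \<and>
        summable (\<lambda>j. cmod (P (q * Suc j) (\<mu> z))) \<and>
        summable (\<lambda>j. (cmod (P (q * Suc j) (\<mu> z)))\<^sup>2) \<and>
        bohr_sum k p q f P \<mu> z > 1))"
proof (intro conjI allI impI)
  fix f :: "'a \<Rightarrow> complex" and P and \<mu> :: "'a \<Rightarrow> 'a" and z :: 'a
  assume "f ` ball 0 1 \<subseteq> ball 0 1" "homogeneous_expansion f P"
    "schwarz_map \<mu>" "zero_of_order k \<mu>" "norm z \<le> bohr_radius k p q"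
  note * = bohr_inequality[OF assms(2-4) this]
  show "summable (\<lambda>j. cmod (P (q * Suc j) (\<mu> z)))"
    "summable (\<lambda>j. (cmod (P (q * Suc j) (\<mu> z)))\<^sup>2)"
    "bohr_sum k p q f P \<mu> z \<le> 1"
    by (fact *)+
next
  fix R assume R: "bohr_radius k p q < R \<and> R < 1"
  note radius = bohr_radius_power[OF assms(2-4)]
  have R01: "0 < R" "R < 1" using R radius(2) by auto
  define x where "x = R ^ (q * k)"
  have "q * k > 0" using assms by simp
  then have "bohr_radius k p q ^ (q * k) < x" "x < 1"
    using R R01 radius(2) unfolding x_def
    by (auto intro!: power_strict_mono simp: power_less_one_iff)
  then obtain a where a: "0 \<le> a" "a < 1"
    and gt: "1 < a powr p + (1 - a\<^sup>2) * (x / (1 - a * x))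
        + (1 / (1 + a) + x / (1 - x)) * (((1 - a\<^sup>2) * x)\<^sup>2 / (1 - (a * x)\<^sup>2))"
    using extremal_parameter[OF \<open>p > 0\<close>, of x] unfolding radius(1) by blast
  obtain v :: 'a where "v \<noteq> 0" using nontrivial by blast
  define u where "u = sgn v"
  have u: "norm u = 1" using \<open>v \<noteq> 0\<close> by (simp add: u_def norm_sgn)
  obtain \<phi> :: "'a \<Rightarrow> complex" where \<phi>: "bounded_linear \<phi>" "\<And>c x. \<phi> (c *\<^sub>C x) = c * \<phi> x"
    "\<And>x. cmod (\<phi> x) \<le> norm x" "\<phi> u = of_real (norm u)"
    using norming_functional[of u] by blast
  interpret unit_functional \<phi> by (rule unit_functional.intro) (fact \<phi>)+
  have \<phi>u: "\<phi> u = 1" using \<phi>(4) u by simp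
  note bohr = extremal_bohr_sum[OF a \<open>q \<ge> 1\<close> \<open>k \<ge> 1\<close> u \<phi>u R01]
  show "\<exists>(f :: 'a \<Rightarrow> complex) P \<mu> z.
        holomorphic_map_on f (ball 0 1) \<and> f ` ball 0 1 \<subseteq> ball 0 1 \<and>
        homogeneous_expansion f P \<and>
        schwarz_map \<mu> \<and> zero_of_order k \<mu> \<and>
        norm z \<le> R \<and>
        summable (\<lambda>j. cmod (P (q * Suc j) (\<mu> z))) \<and>
        summable (\<lambda>j. (cmod (P (q * Suc j) (\<mu> z)))\<^sup>2) \<and>
        bohr_sum k p q f P \<mu> z > 1"
  proof (intro exI conjI)
    show "norm (of_real R *\<^sub>C u) \<le> R" using R01 u by (simp add: norm_scaleC)
    show "1 < bohr_sum k p q (extremal a q) (extremal_poly a q) (\<lambda>x. \<phi> x ^ k *\<^sub>C u) (of_real R *\<^sub>C u)"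
      using gt by (simp only: bohr(3) x_def)
  qed (fact extremal[OF a \<open>q \<ge> 1\<close>] power_schwarz_map[OF u \<phi>u \<open>k \<ge> 1\<close>] bohr)+
qed

end
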